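(* $\mathrm{BMO}^d=\left(F^{02d}_1\right)^*$, in the following sense. For every $\varphi\in\mathrm{BMO}^d$ the series $l_\varphi(f)=\sum_{J\in D}(f,h_J)(\varphi,h_J)$ converges absolutely for every $f\in F^{02d}_1$ and defines a continuous linear functional $l_\varphi$ on $F^{02d}_1$; conversely, for every continuous linear functional $l$ on $F^{02d}_1$ there exists $\varphi\in\mathrm{BMO}^d$ such that $l=l_\varphi$.
   Context: $\mathbb T$ is the unit circle with arc length measure $d\theta$ normalized so that $|\mathbb T|=1$. All functions are real-valued. $D=D_{\mathbb T}$ is the dyadic lattice on $\mathbb T$: it contains $\mathbb T$ itself and, with each arc $I$, its left and right halves $I_-$ and $I_+$ (so the lengths are $|I|=2^{-k}$, $k\ge 0$). For $f\in L^1(\mathbb T)$ and $I\in D$ put $\langle f\rangle_I=\frac1{|I|}\int_I f(\theta)\,d\theta$. The Haar function $h_I$ equals $|I|^{-1/2}$ on $I_-$, $-|I|^{-1/2}$ on $I_+$ and $0$ elsewhere, and $(f,h_I)=\int_{\mathbb T} f h_I\,d\theta=\frac{\sqrt{|I|}}2\left(\langle f\rangle_{I_-}-\langle f\rangle_{I_+}\right)$. The dyadic Triebel-Lizorkin space $F^{02d}_1$ is the space of all $f\in L^1(\mathbb T)$ with $$\|f\|_{F^{02d}_1}=\int_{\mathbb T}\Bigl(\sum_{I\ni\theta,\,I\in D}\left(\langle f\rangle_{I_+}-\langle f\rangle_{I_-}\right)^2\Bigr)^{1/2}d\theta<\infty$$ (constants have norm zero), and $(F^{02d}_1)^*$ is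 the space of linear functionals that are continuous with respect to this norm. $\mathrm{BMO}^d$ is the space of all $\varphi\in L^1(\mathbb T)$ with $$\|\varphi\|_{\mathrm{BMO}^d}=\sup_{J\in D}\Bigl(\frac1{|J|}\sum_{I\in D,\,I\subset J}\left(\langle \varphi\rangle_{I_+}-\langle \varphi\rangle_{I_-}\right)^2|I|\Bigr)^{1/2}<\infty$$ (again constants have norm zero). For $f\in L^2(\mathbb T)$ with $\int_{\mathbb T}f\,d\theta=0$, the pairing $\sum_{J\in D}(f,h_J)(\varphi,h_J)$ equals $\int_{\mathbb T}\varphi f\,d\theta$. *)

theory Defs
  imports "HOL-Analysis.Analysis"
begin

section \<open>The circle and its dyadic arcs\<close>

text \<open>
  The circle is the unit circle of \<^typ>\<open>complex\<close>, parametrized by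
  \<open>t \<mapsto> exp (2 \<pi> i t)\<close> with \<open>t \<in> [0,1)\<close>; normalized arc length is the image of
  Lebesgue measure under this map.  Real functions on the circle are represented by functions
  \<open>complex \<Rightarrow> real\<close>; their values off the circle are irrelevant.
\<close>

definition circle_point :: "real \<Rightarrow> complex" where
  "circle_point t = cis (2 * pi * t)"

definition circle :: "complex measure" where
  "circle = distr (restrict_space lborel {0..<1}) (restrict_space borel (sphere 0 1)) circle_point"

text \<open>
  The dyadic arcs are indexed by pairs \<open>(k, j)\<close> with \<open>j < 2 ^ k\<close>, the index \<open>(k, j)\<close> standing
  for the \<open>j\<close>-th arc of length \<open>2 ^ -k\<close>. The correspondence between indices and arcs is
  bijective (lemma \<open>inj_on_arc\<close>), so sums over indices are sums over arcs.
\<close>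

type_synonym dyadic = "nat \<times> nat"

definition dyadic_indices :: "dyadic set" where
  "dyadic_indices = {(k, j). j < 2 ^ k}"

fun dyadic_arc :: "dyadic \<Rightarrow> complex set" where
  "dyadic_arc (k, j) = circle_point ` {real j / 2 ^ k ..< (real j + 1) / 2 ^ k}"

fun left_half :: "dyadic \<Rightarrow> dyadic" where
  "left_half (k, j) = (Suc k, 2 * j)"

fun right_half :: "dyadic \<Rightarrow> dyadic" where
  "right_half (k, j) = (Suc k, 2 * j + 1)"

definition arc_length :: "dyadic \<Rightarrow> real" where
  "arc_length I = measure circle (dyadic_arc I)"

lemma space_circle: "space circle = sphere 0 1"
  by (simp add: circle_def space_restrict_space)

lemma circle_point_measurable:
  "circle_point \<in> measurable (restrict_space lborel {0..<1}) (restrict_space borel (sphere 0 1))"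
proof (rule measurable_restrict_space2)
  show "circle_point \<in> borel_measurable (restrict_space lborel {0..<1})"
    unfolding circle_point_def
    by (intro measurable_restrict_space1)
       (simp, intro borel_measurable_continuous_onI continuous_intros)
qed (auto simp: circle_point_def)

lemma inj_on_circle_point: "inj_on circle_point {0..<1}"
proof (rule inj_onI)
  fix s t :: real assume st: "s \<in> {0..<1}" "t \<in> {0..<1}" "circle_point s = circle_point t"
  have "cis (2 * pi * s) / cis (2 * pi * t) = 1"
    using st by (simp add: circle_point_def)
  then have "cis (2 * pi * s - 2 * pi * t) = 1" by (simp add: cis_divide)
  then have "cos (2 * pi * s - 2 * pi * t) = 1" by (metis cis.sel(1) one_complex.sel(1))
  then obtain n :: int where "2 * pi * s - 2 * pi * t = of_int n * 2 * pi"
    by (auto simp: cos_one_2pi_int)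
  then have "2 * pi * (s - t) = 2 * pi * of_int n" by (simp add: algebra_simps)
  then have n: "s - t = of_int n" by simp
  with st have "\<bar>real_of_int n\<bar> < 1" by auto
  then have "n = 0" by linarith
  with n show "s = t" by simp
qed

lemma arc_interval_subset:
  assumes "(k, j) \<in> dyadic_indices"
  shows "{real j / 2 ^ k ..< (real j + 1) / 2 ^ k} \<subseteq> {0..<1}"
proof -
  have "Suc j \<le> 2 ^ k" using assms by (simp add: dyadic_indices_def)
  then have "real (Suc j) \<le> real (2 ^ k)" by (simp only: of_nat_le_iff)
  then have "(real j + 1) / 2 ^ k \<le> 1" by (simp add: add.commute)
  then show ?thesis by (auto intro: order_trans)
qed

lemma arc_root: "dyadic_arc (0, 0) = sphere 0 1"
proof -
  have "x \<in> circle_point ` {0..<1}" if x: "norm x = 1" for x :: complex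
  proof -
    have "x = cis (Arg2pi x)" using Arg2pi_eq[of x] x by (simp add: cis_conv_exp)
    then obtain t where t: "0 \<le> t" "t < 2 * pi" "x = cis t"
      using Arg2pi_ge_0 Arg2pi_lt_2pi by metis
    then show ?thesis
      by (intro image_eqI[of _ _ "t / (2 * pi)"]) (auto simp: circle_point_def)
  qed
  then show ?thesis by (auto simp: circle_point_def)
qed

lemma arc_halves:
  assumes "I \<in> dyadic_indices"
  shows "left_half I \<in> dyadic_indices" "right_half I \<in> dyadic_indices"
    and "dyadic_arc (left_half I) \<union> dyadic_arc (right_half I) = dyadic_arc I"
    and "dyadic_arc (left_half I) \<inter> dyadic_arc (right_half I) = {}"
proof -
  obtain k j where I: "I = (k, j)" by (cases I)
  show d: "left_half I \<in> dyadic_indices" "right_half I \<in> dyadic_indices"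
    using assms by (auto simp: I dyadic_indices_def)
  let ?L = "{real (2 * j) / 2 ^ Suc k ..< (real (2 * j) + 1) / 2 ^ Suc k}"
  let ?R = "{real (2 * j + 1) / 2 ^ Suc k ..< (real (2 * j + 1) + 1) / 2 ^ Suc k}"
  have "real (2 * j) / 2 ^ Suc k \<le> (real (2 * j) + 1) / 2 ^ Suc k"
    "real (2 * j + 1) / 2 ^ Suc k \<le> (real (2 * j + 1) + 1) / 2 ^ Suc k"
    by (intro divide_right_mono; simp)+
  moreover have "real (2 * j + 1) = real (2 * j) + 1" by simp
  ultimately have "?L \<union> ?R = {real (2 * j) / 2 ^ Suc k ..< (real (2 * j + 1) + 1) / 2 ^ Suc k}"
    by (metis ivl_disj_un_two(3))
  also have "\<dots> = {real j / 2 ^ k ..< (real j + 1) / 2 ^ k}"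
    by (simp add: add_divide_distrib add.commute)
  finally show "dyadic_arc (left_half I) \<union> dyadic_arc (right_half I) = dyadic_arc I"
    by (simp only: I left_half.simps right_half.simps dyadic_arc.simps image_Un[symmetric])
  have "?L \<inter> ?R = {}" by (auto simp: add.commute)
  moreover have "?L \<subseteq> {0..<1}" "?R \<subseteq> {0..<1}"
    using d arc_interval_subset by (simp_all only: I left_half.simps right_half.simps)
  ultimately show "dyadic_arc (left_half I) \<inter> dyadic_arc (right_half I) = {}"
    using inj_on_image_Int[OF inj_on_circle_point, of ?L ?R]
    by (simp only: I left_half.simps right_half.simps dyadic_arc.simps image_empty)
qed

lemma arc_measurable_length:
  assumes "I \<in> dyadic_indices"
  shows "dyadic_arc I \<in> sets circle" and "arc_length I = 1 / 2 ^ fst I"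
proof -
  obtain k j where I: "I = (k, j)" by (cases I)
  let ?a = "real j / 2 ^ k" and ?b = "(real j + 1) / 2 ^ k"
  have sub: "{?a..<?b} \<subseteq> {0..<1}" using assms I arc_interval_subset by simp
  have "{?a..<?b} = (\<Union>n. {?a..?b - 1 / real (Suc n)})"
  proof (intro set_eqI iffI)
    fix x assume x: "x \<in> {?a..<?b}"
    then obtain n where "1 / real (Suc n) < ?b - x"
      using nat_approx_posE[of "?b - x"] by auto
    with x show "x \<in> (\<Union>n. {?a..?b - 1 / real (Suc n)})"
      by (intro UN_I[of n]) auto
  next
    fix x assume "x \<in> (\<Union>n. {?a..?b - 1 / real (Suc n)})"
    then obtain n where "?a \<le> x" "x \<le> ?b - 1 / real (Suc n)" by auto
    moreover have "0 < 1 / real (Suc n)" by simp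
    ultimately have "x < ?b" by linarith
    with \<open>?a \<le> x\<close> show "x \<in> {?a..<?b}" by simp
  qed
  then have eq: "dyadic_arc I = (\<Union>n. circle_point ` {?a..?b - 1 / real (Suc n)})"
    by (simp only: I dyadic_arc.simps image_UN)
  have "compact (circle_point ` {?a..?b - 1 / real (Suc n)})" for n
    unfolding circle_point_def
    by (intro compact_continuous_image continuous_intros compact_Icc)
  then have "dyadic_arc I \<in> sets borel"
    unfolding eq by (intro sets.countable_UN) (auto intro: borel_compact)
  then show m: "dyadic_arc I \<in> sets circle"
    unfolding circle_def sets_distr sets_restrict_space
    by (intro image_eqI[of _ _ "dyadic_arc I"]) (auto simp: I circle_point_def)
  have "circle_point -` dyadic_arc I \<inter> {0..<1} = {?a..<?b}"
    using sub inj_on_image_mem_iff[OF inj_on_circle_point _ sub]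
    unfolding I dyadic_arc.simps by blast
  moreover have "dyadic_arc I \<in> sets (restrict_space borel (sphere 0 1))"
    using m by (simp add: circle_def)
  ultimately have "arc_length I = measure (restrict_space lborel {0..<1}) {?a..<?b}"
    by (simp add: arc_length_def circle_def measure_distr[OF circle_point_measurable]
        space_restrict_space)
  also have "\<dots> = ?b - ?a"
    using sub by (subst measure_restrict_space) (auto simp: divide_right_mono)
  also have "\<dots> = 1 / 2 ^ fst I"
    by (simp add: I diff_divide_distrib[symmetric])
  finally show "arc_length I = 1 / 2 ^ fst I" .
qed

lemma inj_on_arc: "inj_on dyadic_arc dyadic_indices"
proof (rule inj_onI)
  fix I J assume IJ: "I \<in> dyadic_indices" "J \<in> dyadic_indices" "dyadic_arc I = dyadic_arc J"
  obtain k i where I: "I = (k, i)" by (cases I)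
  obtain k' j where J: "J = (k', j)" by (cases J)
  have "arc_length I = arc_length J" using IJ(3) by (simp add: arc_length_def)
  then have k: "k' = k" using arc_measurable_length(2) IJ I J by simp
  have "{real i / 2 ^ k ..< (real i + 1) / 2 ^ k} = {real j / 2 ^ k ..< (real j + 1) / 2 ^ k}"
    (is "?A = ?B")
  proof -
    have "?A \<subseteq> {0..<1}" "?B \<subseteq> {0..<1}"
      using IJ arc_interval_subset unfolding I J k by blast+
    moreover have "circle_point ` ?A = circle_point ` ?B"
      using IJ(3) unfolding I J k dyadic_arc.simps .
    ultimately show ?thesis using inj_on_image_eq_iff[OF inj_on_circle_point] by blast
  qed
  moreover have "real i / 2 ^ k < (real i + 1) / 2 ^ k" "real j / 2 ^ k < (real j + 1) / 2 ^ k"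
    by (intro divide_strict_right_mono; simp)+
  ultimately have "real i / 2 ^ k = real j / 2 ^ k"
    using atLeastLessThan_eq_iff by metis
  then show "I = J" by (simp add: I J k)
qed

section \<open>Averages and Haar functions\<close>

definition avg :: "(complex \<Rightarrow> real) \<Rightarrow> dyadic \<Rightarrow> real" where
  "avg f I = (1 / arc_length I) * (LINT \<theta>:dyadic_arc I|circle. f \<theta>)"

definition haar :: "dyadic \<Rightarrow> complex \<Rightarrow> real" where
  "haar I \<theta> =
     (if \<theta> \<in> dyadic_arc (left_half I) then 1 / sqrt (arc_length I)
      else if \<theta> \<in> dyadic_arc (right_half I) then - 1 / sqrt (arc_length I)
      else 0)"

definition haar_coeff :: "(complex \<Rightarrow> real) \<Rightarrow> dyadic \<Rightarrow> real" where
  "haar_coeff f I = (LINT \<theta>|circle. f \<theta> * haar I \<theta>)"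

section \<open>The dyadic Triebel-Lizorkin space and dyadic BMO\<close>

text \<open>
  Both norms may be infinite, so they take values in \<^typ>\<open>ennreal\<close>, where the sums and the
  integral below always exist; \<open>esqrt\<close> is the square root on \<open>[0, \<infinity>]\<close>.
\<close>

definition esqrt :: "ennreal \<Rightarrow> ennreal" where
  "esqrt x = (if x = \<infinity> then \<infinity> else ennreal (sqrt (enn2real x)))"

definition F_norm :: "(complex \<Rightarrow> real) \<Rightarrow> ennreal" where
  "F_norm f =
     (\<integral>\<^sup>+ \<theta>. esqrt (\<Sum>\<^sub>\<infinity>I\<in>{I \<in> dyadic_indices. \<theta> \<in> dyadic_arc I}.
        ennreal ((avg f (right_half I) - avg f (left_half I))\<^sup>2)) \<partial>circle)"

definition F_space :: "(complex \<Rightarrow> real) set" where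
  "F_space = {f. integrable circle f \<and> F_norm f < \<infinity>}"

definition BMO_norm :: "(complex \<Rightarrow> real) \<Rightarrow> ennreal" where
  "BMO_norm \<phi> =
     (SUP J\<in>dyadic_indices. esqrt (ennreal (1 / arc_length J) *
        (\<Sum>\<^sub>\<infinity>I\<in>{I \<in> dyadic_indices. dyadic_arc I \<subseteq> dyadic_arc J}.
           ennreal ((avg \<phi> (right_half I) - avg \<phi> (left_half I))\<^sup>2 * arc_length I))))"

definition BMO_space :: "(complex \<Rightarrow> real) set" where
  "BMO_space = {\<phi>. integrable circle \<phi> \<and> BMO_norm \<phi> < \<infinity>}"

section \<open>The dual of the dyadic Triebel-Lizorkin space\<close>

text \<open>
  The elements of \<open>F_space\<close> are functions, not classes modulo null sets, and \<open>F_norm\<close> is a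
  seminorm on them. A continuous linear functional takes equal values at functions that differ
  by an element of seminorm zero, in particular at almost everywhere equal functions, so the
  functionals below are those on the quotient. Only the values on \<open>F_space\<close> are constrained.
\<close>

definition linear_on_F :: "((complex \<Rightarrow> real) \<Rightarrow> real) \<Rightarrow> bool" where
  "linear_on_F l \<longleftrightarrow>
     (\<forall>f\<in>F_space. \<forall>g\<in>F_space. l (\<lambda>\<theta>. f \<theta> + g \<theta>) = l f + l g) \<and>
     (\<forall>c. \<forall>f\<in>F_space. l (\<lambda>\<theta>. c * f \<theta>) = c * l f)"

definition continuous_on_F :: "((complex \<Rightarrow> real) \<Rightarrow> real) \<Rightarrow> bool" where
  "continuous_on_F l \<longleftrightarrow>
     (\<forall>f\<in>F_space. \<forall>\<epsilon>>0. \<exists>\<delta>>0. \<forall>g\<in>F_space.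
        F_norm (\<lambda>\<theta>. g \<theta> - f \<theta>) < ennreal \<delta> \<longrightarrow> \<bar>l g - l f\<bar> < \<epsilon>)"

definition F_dual :: "((complex \<Rightarrow> real) \<Rightarrow> real) set" where
  "F_dual = {l. linear_on_F l \<and> continuous_on_F l}"

text \<open>By lemma \<open>inj_on_arc\<close> this is the sum over all dyadic arcs, taken without an ordering.\<close>

definition haar_functional :: "(complex \<Rightarrow> real) \<Rightarrow> (complex \<Rightarrow> real) \<Rightarrow> real" where
  "haar_functional \<phi> f = (\<Sum>\<^sub>\<infinity>J\<in>dyadic_indices. haar_coeff f J * haar_coeff \<phi> J)"

end

theory Submission
  imports Defs
begin

text \<open>
  Both norms depend only on the jumps \<open>d\<^sub>I(f) = avg f (right_half I) - avg f (left_half I)\<close>, and a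
  Haar coefficient is a jump up to the factor \<open>- sqrt \<bar>I\<bar> / 2\<close>. The theorem is therefore a duality
  between two spaces of families of numbers indexed by the dyadic tree.

  A BMO function acts continuously by Fefferman's inequality
  \<open>\<Sum> \<bar>I\<bar> \<bar>d\<^sub>I(f) d\<^sub>I(\<phi>)\<bar> \<le> (3/2) \<parallel>\<phi>\<parallel> \<parallel>f\<parallel>\<close> (\<open>fefferman_inequality\<close>). Let \<open>S\<^sub>I\<close> be the square root of
  the sum of \<open>d\<^sub>J(f)\<^sup>2\<close> over the arcs \<open>J\<close> containing \<open>I\<close>, let \<open>S\<^sub>p\<close> be its value at the parent
  (\<open>0\<close> for the root), and let \<open>B\<close> be a bound for the BMO norm. By the inequality between the means,
  \<open>\<bar>d\<^sub>I(f) d\<^sub>I(\<phi>)\<bar> \<le> B d\<^sub>I(f)\<^sup>2 / (2 S\<^sub>I) + S\<^sub>I d\<^sub>I(\<phi>)\<^sup>2 / (2 B)\<close>. In the first term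
  \<open>d\<^sub>I(f)\<^sup>2 = S\<^sub>I\<^sup>2 - S\<^sub>p\<^sup>2 \<le> 2 S\<^sub>I (S\<^sub>I - S\<^sub>p)\<close>, so its sum telescopes to the integral of the square function. In
  the second term one writes \<open>S\<^sub>I\<close> as the sum of the increments \<open>S\<^sub>J - S\<^sub>p\<close> over the arcs \<open>J\<close> containing
  \<open>I\<close> and exchanges the sums: the total mass \<open>\<bar>I\<bar> d\<^sub>I(\<phi>)\<^sup>2\<close> below \<open>J\<close> is at most \<open>B\<^sup>2 \<bar>J\<bar>\<close>, which is
  exactly the BMO condition, and again the sum telescopes. Both summations are carried out at once,
  by induction on the level (\<open>tree_fefferman\<close>).

  Conversely, let \<open>l\<close> be a continuous functional, with bound \<open>C\<close>, and \<open>b\<^sub>I = l(h\<^sub>I)\<close>. Testing \<open>l\<close> on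
  \<open>\<Sum> b\<^sub>I h\<^sub>I\<close>, summed over finitely many arcs inside \<open>J\<close>, gives \<open>\<Sum> b\<^sub>I\<^sup>2\<close> on one side, and on the
  other \<open>C\<close> times the \<open>L\<^sup>1\<close> norm of a square function that lives on \<open>J\<close>, which is at most
  \<open>sqrt \<bar>J\<bar>\<close> times its \<open>L\<^sup>2\<close> norm. Hence \<open>\<Sum> b\<^sub>I\<^sup>2 \<le> 4 C\<^sup>2 \<bar>J\<bar>\<close>. For \<open>J\<close> the whole circle this lets a
  Riesz-Fischer argument (\<open>riesz_fischer_haar\<close>) produce \<open>\<phi>\<close> with Haar coefficients \<open>b\<close>; for all \<open>J\<close> it
  says that \<open>\<phi>\<close> is in BMO. Now \<open>l\<close> and the functional of \<open>\<phi>\<close> agree on Haar functions, hence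
  everywhere, because finite Haar sums are dense (\<open>haar_sums_dense\<close>).
\<close>

section \<open>The dyadic address of a point\<close>

text \<open>
  From here on arcs are handled through addresses and not through the parametrizing intervals.
\<close>

declare dyadic_arc.simps [simp del]

lemma arc_subset_circle: "dyadic_arc I \<subseteq> sphere 0 1"
  by (cases I) (auto simp: dyadic_arc.simps circle_point_def)

text \<open>
  The index of the arc of level \<open>k\<close> that contains \<open>\<theta>\<close>. Descending the tree instead of rounding the
  angle makes the relation between consecutive levels immediate. Off the circle the value has no
  meaning, since no arc contains the point.
\<close>

primrec position :: "nat \<Rightarrow> complex \<Rightarrow> nat" where
  "position 0 \<theta> = 0"
| "position (Suc k) \<theta> =
     (if \<theta> \<in> dyadic_arc (left_half (k, position k \<theta>)) then 2 * position k \<theta>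
      else 2 * position k \<theta> + 1)"

lemma position_less: "position k \<theta> < 2 ^ k"
  by (induction k) auto

lemma position_index [simp]: "(k, position k \<theta>) \<in> dyadic_indices"
  by (simp add: dyadic_indices_def position_less)

lemma position_div: "position (Suc k) \<theta> div 2 = position k \<theta>"
  by simp

lemma position_div_power: "m \<le> k \<Longrightarrow> position m \<theta> = position k \<theta> div 2 ^ (k - m)"
proof (induction "k - m" arbitrary: m)
  case (Suc d)
  then have "position (Suc m) \<theta> = position k \<theta> div 2 ^ (k - Suc m)"
    by (simp del: position.simps(2))
  then have "position m \<theta> = position k \<theta> div 2 ^ (k - Suc m) div 2"
    by (metis position_div)
  also have "\<dots> = position k \<theta> div 2 ^ (k - m)"
    using Suc.hyps(2) by (metis Suc_diff_Suc div_mult2_eq power_Suc2 zero_less_Suc zero_less_diff)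
  finally show ?case .
qed simp

lemma arc_iff_position:
  assumes "norm \<theta> = 1" "j < 2 ^ k"
  shows "\<theta> \<in> dyadic_arc (k, j) \<longleftrightarrow> j = position k \<theta>"
  using assms(2)
proof (induction k arbitrary: j)
  case 0
  then show ?case using assms(1) arc_root by simp
next
  case (Suc k)
  define p where "p = position k \<theta>"
  have p: "(k, p) \<in> dyadic_indices" by (simp add: p_def)
  have in_p: "\<theta> \<in> dyadic_arc (k, p)"
    using Suc.IH[of p] by (simp add: p_def position_less)
  have dich: "\<theta> \<in> dyadic_arc (Suc k, 2 * p) \<longleftrightarrow> \<theta> \<notin> dyadic_arc (Suc k, 2 * p + 1)"
    using arc_halves(3,4)[OF p] in_p by auto
  define i where "i = j div 2"
  have i: "i < 2 ^ k" using Suc.prems by (auto simp: i_def)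
  then have iD: "(k, i) \<in> dyadic_indices" by (simp add: dyadic_indices_def)
  have j: "j = 2 * i \<or> j = 2 * i + 1" by (auto simp: i_def)
  have "\<theta> \<in> dyadic_arc (Suc k, j) \<Longrightarrow> i = p"
    using arc_halves(3)[OF iD] j Suc.IH[OF i] by (auto simp: p_def)
  then show ?case using j dich by (auto simp: p_def)
qed

lemma arcs_containing:
  assumes "norm \<theta> = 1"
  shows "{I \<in> dyadic_indices. \<theta> \<in> dyadic_arc I} = range (\<lambda>k. (k, position k \<theta>))"
  using arc_iff_position[OF assms] by (auto simp: dyadic_indices_def position_less)

lemma infsum_arcs_containing:
  fixes g :: "dyadic \<Rightarrow> ennreal"
  assumes "norm \<theta> = 1"
  shows "(\<Sum>\<^sub>\<infinity>I\<in>{I \<in> dyadic_indices. \<theta> \<in> dyadic_arc I}. g I) = (\<Sum>k. g (k, position k \<theta>))"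
proof -
  have "inj (\<lambda>k. (k, position k \<theta>))" by (auto intro: injI)
  then have "infsum g (range (\<lambda>k. (k, position k \<theta>)))
      = infsum (\<lambda>k. g (k, position k \<theta>)) UNIV"
    by (simp add: infsum_reindex o_def)
  also have "\<dots> = (\<Sum>k. g (k, position k \<theta>))"
    by (intro sums_unique has_sum_imp_sums has_sum_infsum nonneg_summable_on_complete) simp
  finally show ?thesis using arcs_containing[OF assms] by simp
qed

text \<open>
  A function of the level-\<open>k\<close> address is a step function; in this form measurability and integrals
  are read off.
\<close>

lemma position_indicator:
  fixes g :: "dyadic \<Rightarrow> ennreal"
  assumes "norm \<theta> = 1"
  shows "g (k, position k \<theta>) = (\<Sum>j<2 ^ k. g (k, j) * indicator (dyadic_arc (k, j)) \<theta>)"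
proof -
  have "(\<Sum>j<2 ^ k. g (k, j) * indicator (dyadic_arc (k, j)) \<theta>)
      = (\<Sum>j<2 ^ k. if j = position k \<theta> then g (k, j) else 0)"
    using arc_iff_position[OF assms] by (intro sum.cong) (auto simp: indicator_def)
  then show ?thesis using position_less by (simp add: sum.delta)
qed

lemma measure_circle: "measure circle (space circle) = 1"
  using arc_measurable_length(2)[of "(0, 0)"] arc_root
  by (simp add: arc_length_def space_circle dyadic_indices_def)

lemma finite_measure_circle: "finite_measure circle"
  by (rule finite_measureI) (use measure_circle in \<open>auto simp: measure_def\<close>)

lemma arc_sets [measurable]: "I \<in> dyadic_indices \<Longrightarrow> dyadic_arc I \<in> sets circle"
  by (rule arc_measurable_length)

lemma level_sets [measurable]: "j < 2 ^ k \<Longrightarrow> dyadic_arc (k, j) \<in> sets circle"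
  by (rule arc_sets) (simp add: dyadic_indices_def)

lemma emeasure_arc: "I \<in> dyadic_indices \<Longrightarrow> emeasure circle (dyadic_arc I) = ennreal (1 / 2 ^ fst I)"
  using arc_measurable_length(2)[of I]
  by (simp add: arc_length_def finite_measure.emeasure_eq_measure[OF finite_measure_circle])

lemma position_measurable:
  fixes g :: "dyadic \<Rightarrow> ennreal"
  shows "(\<lambda>\<theta>. g (k, position k \<theta>)) \<in> borel_measurable circle"
proof -
  have "(\<lambda>\<theta>. \<Sum>j<2 ^ k. g (k, j) * indicator (dyadic_arc (k, j)) \<theta>) \<in> borel_measurable circle"
    by (intro borel_measurable_sum borel_measurable_times_ennreal borel_measurable_const
        borel_measurable_indicator level_sets) auto
  then show ?thesis
    by (rule measurable_cong[THEN iffD1, rotated])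
       (simp add: position_indicator[of _ g] space_circle)
qed

lemma nn_integral_position:
  fixes g :: "dyadic \<Rightarrow> ennreal"
  shows "(\<integral>\<^sup>+\<theta>. g (k, position k \<theta>) \<partial>circle) = (\<Sum>j<2 ^ k. g (k, j) * ennreal (1 / 2 ^ k))"
proof -
  have "(\<integral>\<^sup>+\<theta>. g (k, position k \<theta>) \<partial>circle)
      = (\<integral>\<^sup>+\<theta>. (\<Sum>j<2 ^ k. g (k, j) * indicator (dyadic_arc (k, j)) \<theta>) \<partial>circle)"
    by (intro nn_integral_cong) (simp add: position_indicator[of _ g] space_circle)
  also have "\<dots> = (\<Sum>j<2 ^ k. \<integral>\<^sup>+\<theta>. g (k, j) * indicator (dyadic_arc (k, j)) \<theta> \<partial>circle)"
    by (intro nn_integral_sum borel_measurable_times_ennreal borel_measurable_const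
        borel_measurable_indicator level_sets) auto
  also have "\<dots> = (\<Sum>j<2 ^ k. g (k, j) * ennreal (1 / 2 ^ k))"
    by (intro sum.cong refl)
       (simp add: nn_integral_cmult_indicator level_sets emeasure_arc dyadic_indices_def)
  finally show ?thesis .
qed

section \<open>The square root on the extended half-line\<close>

lemma esqrt_ennreal: "0 \<le> x \<Longrightarrow> esqrt (ennreal x) = ennreal (sqrt x)"
  by (simp add: esqrt_def)

lemma esqrt_measurable [measurable]: "esqrt \<in> borel_measurable borel"
  unfolding esqrt_def by measurable

lemma esqrt_mono: "x \<le> y \<Longrightarrow> esqrt x \<le> esqrt y"
  by (cases x; cases y) (auto simp: esqrt_def top_unique)

lemma esqrt_square_mult: "0 \<le> c \<Longrightarrow> esqrt (ennreal (c\<^sup>2) * x) \<le> ennreal c * esqrt x"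
  by (cases x; cases "c = 0")
     (auto simp: esqrt_def ennreal_mult[symmetric] real_sqrt_mult ennreal_mult_top ennreal_mult_eq_top_iff)

lemma esqrt_le_square: "0 \<le> B \<Longrightarrow> esqrt x \<le> ennreal B \<Longrightarrow> x \<le> ennreal (B\<^sup>2)"
  by (cases x) (auto simp: esqrt_def top_unique real_sqrt_le_iff sqrt_le_D)

text \<open>
  The inequality between the arithmetic and the geometric mean, with a parameter \<open>c\<close> to be
  optimized. It replaces the Cauchy-Schwarz inequality between \<open>L\<^sup>1\<close> and \<open>L\<^sup>2\<close> norms.
\<close>

lemma esqrt_le_linear:
  assumes "0 < c"
  shows "esqrt x \<le> ennreal (c / 2) + ennreal (1 / (2 * c)) * x"
proof (cases x)
  case (real r)
  have "0 \<le> (c - sqrt r)\<^sup>2" by simp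
  then have "2 * c * sqrt r \<le> c\<^sup>2 + r"
    using real by (simp add: power2_eq_square algebra_simps)
  then have "sqrt r \<le> c / 2 + 1 / (2 * c) * r"
    using assms by (simp add: field_simps power2_eq_square)
  then show ?thesis
    using real assms by (simp add: esqrt_ennreal ennreal_mult[symmetric] ennreal_plus[symmetric] del: ennreal_plus)
qed (use assms in \<open>simp add: ennreal_mult_top\<close>)

section \<open>Jumps and Haar coefficients\<close>

definition jump :: "(complex \<Rightarrow> real) \<Rightarrow> dyadic \<Rightarrow> real" where
  "jump f I = avg f (right_half I) - avg f (left_half I)"

definition square_function :: "(dyadic \<Rightarrow> real) \<Rightarrow> complex \<Rightarrow> ennreal" where
  "square_function a \<theta> = esqrt (\<Sum>k. ennreal ((a (k, position k \<theta>))\<^sup>2))"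

lemma square_function_measurable [measurable]:
  "square_function a \<in> borel_measurable circle"
proof -
  have "(\<lambda>\<theta>. ennreal ((a (k, position k \<theta>))\<^sup>2)) \<in> borel_measurable circle" for k
    using position_measurable[of "\<lambda>I. ennreal ((a I)\<^sup>2)"] by simp
  then show ?thesis unfolding square_function_def by measurable
qed

lemma F_norm_square_function: "F_norm f = (\<integral>\<^sup>+\<theta>. square_function (jump f) \<theta> \<partial>circle)"
  unfolding F_norm_def square_function_def jump_def
  by (intro nn_integral_cong arg_cong[where f = esqrt] infsum_arcs_containing)
     (simp add: space_circle)

lemma arc_length_level [simp]: "j < 2 ^ k \<Longrightarrow> arc_length (k, j) = 1 / 2 ^ k"
  by (simp add: arc_measurable_length dyadic_indices_def)

lemma arc_length_pos: "I \<in> dyadic_indices \<Longrightarrow> 0 < arc_length I"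
  by (simp add: arc_measurable_length)

lemma arc_length_halves:
  assumes "I \<in> dyadic_indices"
  shows "arc_length (left_half I) = arc_length I / 2" "arc_length (right_half I) = arc_length I / 2"
  using arc_halves(1,2)[OF assms] assms by (cases I; simp add: arc_measurable_length)+

lemma haar_indicator:
  assumes "I \<in> dyadic_indices"
  shows "haar I \<theta> = (indicator (dyadic_arc (left_half I)) \<theta>
      - indicator (dyadic_arc (right_half I)) \<theta>) / sqrt (arc_length I)"
  using arc_halves(4)[OF assms] by (auto simp: haar_def indicator_def)

lemma set_integrable_arc:
  "integrable circle f \<Longrightarrow> I \<in> dyadic_indices \<Longrightarrow> set_integrable circle (dyadic_arc I) f"
  for f :: "complex \<Rightarrow> real"
  unfolding set_integrable_def by (intro integrable_mult_indicator arc_sets)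

lemma haar_coeff_jump:
  assumes "integrable circle f" and I: "I \<in> dyadic_indices"
  shows "haar_coeff f I = - (sqrt (arc_length I) / 2) * jump f I"
proof -
  let ?L = "dyadic_arc (left_half I)" and ?R = "dyadic_arc (right_half I)" and ?s = "sqrt (arc_length I)"
  have int: "set_integrable circle ?L f" "set_integrable circle ?R f"
    using assms set_integrable_arc arc_halves by blast+
  have "haar_coeff f I = (LINT \<theta>|circle. (indicator ?L \<theta> *\<^sub>R f \<theta> - indicator ?R \<theta> *\<^sub>R f \<theta>) / ?s)"
    unfolding haar_coeff_def by (simp add: haar_indicator[OF I] algebra_simps)
  also have "\<dots> = ((LINT \<theta>:?L|circle. f \<theta>) - (LINT \<theta>:?R|circle. f \<theta>)) / ?s"
    unfolding set_lebesgue_integral_def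
    using int[unfolded set_integrable_def] by (simp add: Bochner_Integration.integral_diff)
  finally have *: "haar_coeff f I = ((LINT \<theta>:?L|circle. f \<theta>) - (LINT \<theta>:?R|circle. f \<theta>)) / ?s" .
  obtain s where s: "0 < s" "arc_length I = s\<^sup>2"
    using arc_length_pos[OF I] by (metis real_sqrt_gt_0_iff real_sqrt_pow2 less_imp_le)
  then show ?thesis
    unfolding * jump_def avg_def arc_length_halves[OF I]
    by (simp add: field_simps power2_eq_square)
qed

lemma jump_square:
  assumes "integrable circle f" "I \<in> dyadic_indices"
  shows "(jump f I)\<^sup>2 * arc_length I = 4 * (haar_coeff f I)\<^sup>2"
  using haar_coeff_jump[OF assms] arc_length_pos[OF assms(2)]
  by (simp add: power_mult_distrib power_divide)

lemma jump_cmult: "jump (\<lambda>\<theta>. c * f \<theta>) I = c * jump f I"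
  by (simp add: jump_def avg_def algebra_simps)

lemma jump_diff:
  assumes "integrable circle f" "integrable circle g" "I \<in> dyadic_indices"
  shows "jump (\<lambda>\<theta>. f \<theta> - g \<theta>) I = jump f I - jump g I"
  using set_integrable_arc[OF assms(1)] set_integrable_arc[OF assms(2)] arc_halves(1,2)[OF assms(3)]
  by (simp add: jump_def avg_def set_integral_diff algebra_simps)

lemma F_norm_cmult: "F_norm (\<lambda>\<theta>. c * f \<theta>) \<le> ennreal \<bar>c\<bar> * F_norm f"
proof -
  have "square_function (jump (\<lambda>\<theta>. c * f \<theta>)) \<theta> \<le> ennreal \<bar>c\<bar> * square_function (jump f) \<theta>" for \<theta>
  proof -
    have "(\<Sum>k. ennreal ((jump (\<lambda>\<theta>. c * f \<theta>) (k, position k \<theta>))\<^sup>2))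
        = ennreal (\<bar>c\<bar>\<^sup>2) * (\<Sum>k. ennreal ((jump f (k, position k \<theta>))\<^sup>2))"
      by (simp add: jump_cmult power_mult_distrib ennreal_mult flip: ennreal_suminf_cmult)
    then show ?thesis
      unfolding square_function_def using esqrt_square_mult[of "\<bar>c\<bar>"] by simp
  qed
  then have "F_norm (\<lambda>\<theta>. c * f \<theta>) \<le> (\<integral>\<^sup>+\<theta>. ennreal \<bar>c\<bar> * square_function (jump f) \<theta> \<partial>circle)"
    unfolding F_norm_square_function by (rule nn_integral_mono)
  then show ?thesis by (simp add: nn_integral_cmult F_norm_square_function)
qed

section \<open>Fefferman's inequality\<close>

lemma sum_halves: "(\<Sum>j<2 * n. g j) = (\<Sum>j<n. g (2 * j) + g (2 * j + 1))" for g :: "nat \<Rightarrow> real"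
  by (induction n) (auto simp: algebra_simps)

text \<open>
  The sum of the squares of \<open>a\<close> over the strict ancestors of the arc \<open>(k, j)\<close>. With strict ancestors
  the sum at the root is \<open>0\<close>, which starts the induction in \<open>tree_fefferman\<close>, and the sum at level \<open>N\<close>
  is the square of the square function truncated to the first \<open>N\<close> levels.
\<close>

primrec past_square :: "(dyadic \<Rightarrow> real) \<Rightarrow> nat \<Rightarrow> nat \<Rightarrow> real" where
  "past_square a 0 j = 0"
| "past_square a (Suc k) j = past_square a k (j div 2) + (a (k, j div 2))\<^sup>2"

lemma past_square_nonneg: "0 \<le> past_square a k j"
  by (induction k arbitrary: j) auto

lemma past_square_position: "past_square a N (position N \<theta>) = (\<Sum>k<N. (a (k, position k \<theta>))\<^sup>2)"
  by (induction N) (auto simp del: position.simps(2) simp: position_div)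

text \<open>
  The induction step of \<open>tree_fefferman\<close> at a single arc of length \<open>m\<close>. Here \<open>x\<close> and \<open>y\<close> are the square
  function before and after the arc is taken into account, \<open>P\<close> is the Carleson mass below the arc
  and \<open>Q\<close> the part of it that the two halves carry. The mass enters only through \<open>P \<le> B\<^sup>2 m\<close>, which
  is multiplied by the increment \<open>y - x \<ge> 0\<close>; this is the exchange of summations in disguise.
\<close>

lemma node_inequality:
  fixes a b m B P Q x :: real
  assumes "0 < B" "0 \<le> m" "0 \<le> x" "P \<le> B\<^sup>2 * m" "b\<^sup>2 * m + Q \<le> P"
  defines "y \<equiv> sqrt (x\<^sup>2 + a\<^sup>2)"
  shows "\<bar>a * b\<bar> * m \<le> 3 * B / 2 * (y - x) * m - (y * Q - x * P) / (2 * B)"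
proof -
  have yx: "x \<le> y" unfolding y_def by (rule real_le_rsqrt) simp
  have y0: "0 \<le> y" and y2: "y\<^sup>2 = x\<^sup>2 + a\<^sup>2" by (simp_all add: y_def)
  \<comment> \<open>If \<open>y = 0\<close> then \<open>a = 0\<close>; otherwise the mean inequality with weights \<open>B\<close> and \<open>y\<close> applies.\<close>
  have key: "\<bar>a * b\<bar> \<le> B * (y - x) + y * b\<^sup>2 / (2 * B)"
  proof (cases "y = 0")
    case True
    then have "a = 0" using y2 by (simp add: sum_power2_eq_zero_iff)
    then show ?thesis using True yx assms by simp
  next
    case False
    then have y: "0 < y" using y0 by simp
    have "a\<^sup>2 = (y - x) * (y + x)" using y2 by (simp add: power2_eq_square algebra_simps)
    also have "\<dots> \<le> (y - x) * (2 * y)" using yx by (intro mult_left_mono) auto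
    finally have a2: "a\<^sup>2 \<le> 2 * y * (y - x)" by (simp add: algebra_simps)
    have "0 \<le> (B * \<bar>a\<bar> - y * \<bar>b\<bar>)\<^sup>2" by simp
    then have "2 * B * y * \<bar>a * b\<bar> \<le> B\<^sup>2 * a\<^sup>2 + y\<^sup>2 * b\<^sup>2"
      by (simp add: power2_diff power_mult_distrib abs_mult algebra_simps)
    also have "\<dots> \<le> B\<^sup>2 * (2 * y * (y - x)) + y\<^sup>2 * b\<^sup>2"
      using a2 by (intro add_right_mono mult_left_mono) auto
    also have "\<dots> = 2 * B * y * (B * (y - x) + y * b\<^sup>2 / (2 * B))"
      using assms(1) by (simp add: field_simps power2_eq_square)
    finally show ?thesis using y assms(1) by simp
  qed
  have "(y - x) * P \<le> (y - x) * (B\<^sup>2 * m)" using yx assms(4) by (intro mult_left_mono) auto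
  moreover have "y * Q \<le> y * (P - b\<^sup>2 * m)" using y0 assms(5) by (intro mult_left_mono) auto
  ultimately have "y * Q - x * P \<le> (y - x) * (B\<^sup>2 * m) - y * (b\<^sup>2 * m)"
    by (simp add: algebra_simps)
  then have "(y * Q - x * P) / (2 * B) \<le> ((y - x) * (B\<^sup>2 * m) - y * (b\<^sup>2 * m)) / (2 * B)"
    using assms(1) by (intro divide_right_mono) auto
  also have "\<dots> = B / 2 * (y - x) * m - y * b\<^sup>2 / (2 * B) * m"
    using assms(1) by (simp add: field_simps power2_eq_square)
  finally have "(y * Q - x * P) / (2 * B) \<le> B / 2 * (y - x) * m - y * b\<^sup>2 / (2 * B) * m" .
  moreover have "\<bar>a * b\<bar> * m \<le> (B * (y - x) + y * b\<^sup>2 / (2 * B)) * m"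
    using key assms(2) by (rule mult_right_mono)
  ultimately have "\<bar>a * b\<bar> * m + (y * Q - x * P) / (2 * B)
      \<le> (B * (y - x) + y * b\<^sup>2 / (2 * B)) * m + (B / 2 * (y - x) * m - y * b\<^sup>2 / (2 * B) * m)"
    by (rule add_mono[rotated])
  also have "\<dots> = 3 * B / 2 * (y - x) * m" by (simp add: field_simps)
  finally show ?thesis by (simp only: le_diff_eq)
qed

text \<open>
  Forward induction on the number of levels. The sum over the first \<open>N\<close> levels is bounded by the
  integral of the truncated square function minus a term that pays in advance for the mass \<open>P\<close>
  still to come below level \<open>N\<close>; with this term the induction closes level by level, and at the end
  it is dropped because it has the right sign.
\<close>

lemma tree_fefferman:
  fixes a b P :: "dyadic \<Rightarrow> real" and B :: real
  assumes B: "0 < B"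
    and P0: "\<And>I. I \<in> dyadic_indices \<Longrightarrow> 0 \<le> P I"
    and PB: "\<And>I. I \<in> dyadic_indices \<Longrightarrow> P I \<le> B\<^sup>2 * arc_length I"
    and Psum: "\<And>I. I \<in> dyadic_indices \<Longrightarrow>
      (b I)\<^sup>2 * arc_length I + (P (left_half I) + P (right_half I)) \<le> P I"
  shows "(\<Sum>k<N. \<Sum>j<2 ^ k. \<bar>a (k, j) * b (k, j)\<bar> * arc_length (k, j))
    \<le> 3 * B / 2 * (\<Sum>j<2 ^ N. sqrt (past_square a N j) * (1 / 2 ^ N))"
proof -
  let ?q = "\<lambda>k j. sqrt (past_square a k j)"
  define \<Phi> where "\<Phi> N = (\<Sum>j<2 ^ N. 3 * B / 2 * ?q N j * (1 / 2 ^ N) - ?q N j * P (N, j) / (2 * B))" for N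
  have "(\<Sum>k<N. \<Sum>j<2 ^ k. \<bar>a (k, j) * b (k, j)\<bar> * arc_length (k, j)) \<le> \<Phi> N"
  proof (induction N)
    case 0
    then show ?case by (simp add: \<Phi>_def)
  next
    case (Suc N)
    let ?y = "\<lambda>j. sqrt (past_square a N j + (a (N, j))\<^sup>2)"
    have "\<Phi> (Suc N) = (\<Sum>j<2 ^ N. 3 * B / 2 * ?y j * (1 / 2 ^ N)
        - ?y j * (P (Suc N, 2 * j) + P (Suc N, 2 * j + 1)) / (2 * B))"
      unfolding \<Phi>_def power_Suc sum_halves
      by (intro sum.cong refl) (simp add: distrib_left add_divide_distrib)
    moreover have "\<Phi> N = (\<Sum>j<2 ^ N. 3 * B / 2 * ?q N j * (1 / 2 ^ N) - ?q N j * P (N, j) / (2 * B))"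
      by (rule \<Phi>_def)
    ultimately have "\<Phi> (Suc N) - \<Phi> N = (\<Sum>j<2 ^ N. 3 * B / 2 * (?y j - ?q N j) * (1 / 2 ^ N)
        - (?y j * (P (Suc N, 2 * j) + P (Suc N, 2 * j + 1)) - ?q N j * P (N, j)) / (2 * B))"
      by (simp only: sum_subtractf[symmetric]) (simp add: algebra_simps diff_divide_distrib)
    also have "\<dots> \<ge> (\<Sum>j<2 ^ N. \<bar>a (N, j) * b (N, j)\<bar> * arc_length (N, j))"
    proof (rule sum_mono)
      fix j :: nat assume "j \<in> {..<2 ^ N}"
      then have j: "(N, j) \<in> dyadic_indices" "j < 2 ^ N" by (simp_all add: dyadic_indices_def)
      show "\<bar>a (N, j) * b (N, j)\<bar> * arc_length (N, j) \<le> 3 * B / 2 * (?y j - ?q N j) * (1 / 2 ^ N)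
        - (?y j * (P (Suc N, 2 * j) + P (Suc N, 2 * j + 1)) - ?q N j * P (N, j)) / (2 * B)"
        using node_inequality[OF B, where m = "1 / 2 ^ N" and x = "?q N j" and P = "P (N, j)"
            and Q = "P (Suc N, 2 * j) + P (Suc N, 2 * j + 1)" and a = "a (N, j)" and b = "b (N, j)"]
          PB[OF j(1)] Psum[OF j(1)] j(2)
        by (simp add: past_square_nonneg)
    qed
    finally show ?case using Suc by simp
  qed
  also have "\<Phi> N \<le> (\<Sum>j<2 ^ N. 3 * B / 2 * ?q N j * (1 / 2 ^ N))"
    unfolding \<Phi>_def using B P0 by (intro sum_mono) (simp add: past_square_nonneg dyadic_indices_def)
  finally show ?thesis by (simp add: sum_distrib_left algebra_simps)
qed

lemma truncated_square_function:
  "ennreal (\<Sum>j<2 ^ N. sqrt (past_square a N j) * (1 / 2 ^ N))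
    \<le> (\<integral>\<^sup>+\<theta>. square_function a \<theta> \<partial>circle)"
proof -
  have "ennreal (\<Sum>j<2 ^ N. sqrt (past_square a N j) * (1 / 2 ^ N))
      = (\<Sum>j<2 ^ N. ennreal (sqrt (past_square a N j)) * ennreal (1 / 2 ^ N))"
    by (simp add: past_square_nonneg ennreal_mult[symmetric] del: times_divide_eq_right)
  also have "\<dots> = (\<integral>\<^sup>+\<theta>. ennreal (sqrt (past_square a N (position N \<theta>))) \<partial>circle)"
    using nn_integral_position[of "\<lambda>(k, j). ennreal (sqrt (past_square a k j))" N] by simp
  also have "\<dots> \<le> (\<integral>\<^sup>+\<theta>. square_function a \<theta> \<partial>circle)"
  proof (rule nn_integral_mono)
    fix \<theta>
    have "ennreal (sqrt (past_square a N (position N \<theta>)))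
        = esqrt (\<Sum>k<N. ennreal ((a (k, position k \<theta>))\<^sup>2))"
      by (simp add: past_square_position esqrt_ennreal sum_nonneg)
    also have "\<dots> \<le> square_function a \<theta>"
      unfolding square_function_def by (intro esqrt_mono sum_le_suminf) auto
    finally show "ennreal (sqrt (past_square a N (position N \<theta>))) \<le> square_function a \<theta>" .
  qed
  finally show ?thesis .
qed

definition subarcs :: "dyadic \<Rightarrow> dyadic set" where
  "subarcs J = {I \<in> dyadic_indices. dyadic_arc I \<subseteq> dyadic_arc J}"

text \<open>
  Extended-valued, since the sum may diverge when \<open>\<phi>\<close> is not in BMO.
\<close>

definition carleson_mass :: "(complex \<Rightarrow> real) \<Rightarrow> dyadic \<Rightarrow> ennreal" where
  "carleson_mass \<phi> J = (\<Sum>\<^sub>\<infinity>I\<in>subarcs J. ennreal ((jump \<phi> I)\<^sup>2 * arc_length I))"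

lemma BMO_norm_carleson_mass:
  "BMO_norm \<phi> = (SUP J\<in>dyadic_indices. esqrt (ennreal (1 / arc_length J) * carleson_mass \<phi> J))"
  by (simp add: BMO_norm_def carleson_mass_def subarcs_def jump_def)

lemma arc_nonempty: "I \<in> dyadic_indices \<Longrightarrow> dyadic_arc I \<noteq> {}"
  using arc_length_pos[of I] by (auto simp: arc_length_def)

lemma carleson_mass_halves:
  assumes J: "J \<in> dyadic_indices"
  shows "ennreal ((jump \<phi> J)\<^sup>2 * arc_length J)
    + (carleson_mass \<phi> (left_half J) + carleson_mass \<phi> (right_half J)) \<le> carleson_mass \<phi> J"
proof -
  let ?L = "left_half J" and ?R = "right_half J"
  let ?g = "\<lambda>I. ennreal ((jump \<phi> I)\<^sup>2 * arc_length I)"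
  note halves = arc_halves[OF J]
  have disj: "subarcs ?L \<inter> subarcs ?R = {}"
    using halves(4) arc_nonempty by (fastforce simp: subarcs_def)
  have "\<not> dyadic_arc J \<subseteq> dyadic_arc ?L" "\<not> dyadic_arc J \<subseteq> dyadic_arc ?R"
    using halves arc_nonempty[OF halves(1)] arc_nonempty[OF halves(2)] by blast+
  then have J_notin: "{J} \<inter> (subarcs ?L \<union> subarcs ?R) = {}" by (auto simp: subarcs_def)
  have s: "?g summable_on A" for A by (rule nonneg_summable_on_complete) simp
  have "?g J + (carleson_mass \<phi> ?L + carleson_mass \<phi> ?R)
      = infsum ?g ({J} \<union> (subarcs ?L \<union> subarcs ?R))"
    unfolding carleson_mass_def
    by (subst infsum_Un_disjoint[OF s s J_notin], subst infsum_Un_disjoint[OF s s disj]) simp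
  also have "\<dots> \<le> carleson_mass \<phi> J"
    unfolding carleson_mass_def
  proof (rule infsum_mono_neutral[OF s s])
    fix x assume "x \<in> {J} \<union> (subarcs ?L \<union> subarcs ?R) - subarcs J"
    then show "?g x \<le> 0" using halves J by (auto simp: subarcs_def)
  qed auto
  finally show ?thesis .
qed

lemma carleson_mass_le:
  assumes "BMO_norm \<phi> \<le> ennreal B" "0 \<le> B" "J \<in> dyadic_indices"
  shows "carleson_mass \<phi> J \<le> ennreal (B\<^sup>2 * arc_length J)"
proof -
  let ?l = "arc_length J"
  have l: "0 < ?l" by (rule arc_length_pos[OF assms(3)])
  have "esqrt (ennreal (1 / ?l) * carleson_mass \<phi> J) \<le> BMO_norm \<phi>"
    unfolding BMO_norm_carleson_mass by (rule SUP_upper[OF assms(3)])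
  then have "ennreal (1 / ?l) * carleson_mass \<phi> J \<le> ennreal (B\<^sup>2)"
    using assms(1,2) by (intro esqrt_le_square) auto
  then have "ennreal ?l * (ennreal (1 / ?l) * carleson_mass \<phi> J) \<le> ennreal ?l * ennreal (B\<^sup>2)"
    by (rule mult_left_mono) simp
  moreover have "ennreal ?l * ennreal (1 / ?l) = 1"
    using l by (simp add: ennreal_mult[symmetric])
  ultimately show ?thesis
    using l by (simp add: mult.assoc[symmetric] ennreal_mult mult.commute)
qed

text \<open>
  The Carleson mass plays the part of \<open>P\<close> in \<open>tree_fefferman\<close>. A product of Haar coefficients is \<open>arc_length J / 4\<close> times
  the product of the jumps, which turns the constant \<open>3 / 2\<close> into \<open>3 / 8\<close>. Bounding finite sums
  suffices, because all terms are nonnegative.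
\<close>

lemma fefferman_inequality:
  assumes f: "integrable circle f" and \<phi>: "integrable circle \<phi>"
    and ft: "F_norm f \<le> ennreal t" "0 \<le> t" and \<phi>B: "BMO_norm \<phi> \<le> ennreal B" "0 < B"
    and A: "finite A" "A \<subseteq> dyadic_indices"
  shows "(\<Sum>J\<in>A. \<bar>haar_coeff f J * haar_coeff \<phi> J\<bar>) \<le> 3 * B * t / 8"
proof -
  obtain N where N: "\<forall>k\<in>fst ` A. k < N"
    using A(1) finite_nat_set_iff_bounded[of "fst ` A"] by auto
  have AS: "A \<subseteq> Sigma {..<N} (\<lambda>k. {..<2 ^ k})"
    using N A(2) by (force simp: dyadic_indices_def)
  define P where "P J = enn2real (carleson_mass \<phi> J)" for J
  have P: "carleson_mass \<phi> J = ennreal (P J)" if "J \<in> dyadic_indices" for J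
    using carleson_mass_le[OF \<phi>B(1) _ that] \<phi>B(2)
    by (auto simp: P_def top_unique less_top intro!: ennreal_enn2real[symmetric] intro: le_less_trans)
  have P0: "0 \<le> P J" for J by (simp add: P_def)
  have tree: "(\<Sum>k<N. \<Sum>j<2 ^ k. \<bar>jump f (k, j) * jump \<phi> (k, j)\<bar> * arc_length (k, j))
      \<le> 3 * B / 2 * (\<Sum>j<2 ^ N. sqrt (past_square (jump f) N j) * (1 / 2 ^ N))"
  proof (rule tree_fefferman[where P = P, OF \<phi>B(2) P0])
    fix I assume I: "I \<in> dyadic_indices"
    have l: "0 < arc_length I" by (rule arc_length_pos[OF I])
    show "P I \<le> B\<^sup>2 * arc_length I"
      using carleson_mass_le[OF \<phi>B(1) _ I] \<phi>B(2) l by (simp add: P[OF I])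
    have "ennreal ((jump \<phi> I)\<^sup>2 * arc_length I + (P (left_half I) + P (right_half I))) \<le> ennreal (P I)"
      using carleson_mass_halves[OF I, of \<phi>] l
      by (simp add: P[OF I] P[OF arc_halves(1)[OF I]] P[OF arc_halves(2)[OF I]] P0)
    then show "(jump \<phi> I)\<^sup>2 * arc_length I + (P (left_half I) + P (right_half I)) \<le> P I"
      by (simp add: P0)
  qed
  have "ennreal (\<Sum>j<2 ^ N. sqrt (past_square (jump f) N j) * (1 / 2 ^ N)) \<le> ennreal t"
    using truncated_square_function[of "jump f" N] ft(1)
    unfolding F_norm_square_function by (rule order_trans)
  then have sq: "(\<Sum>j<2 ^ N. sqrt (past_square (jump f) N j) * (1 / 2 ^ N)) \<le> t"
    using ft(2) by simp
  have "(\<Sum>J\<in>A. \<bar>haar_coeff f J * haar_coeff \<phi> J\<bar>)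
      = (\<Sum>J\<in>A. 1 / 4 * (\<bar>jump f J * jump \<phi> J\<bar> * arc_length J))"
  proof (rule sum.cong[OF refl])
    fix J assume "J \<in> A"
    then have J: "J \<in> dyadic_indices" using A(2) by blast
    have "haar_coeff f J * haar_coeff \<phi> J = 1 / 4 * (jump f J * jump \<phi> J) * arc_length J"
      using arc_length_pos[OF J] by (simp add: haar_coeff_jump[OF f J] haar_coeff_jump[OF \<phi> J])
    then show "\<bar>haar_coeff f J * haar_coeff \<phi> J\<bar> = 1 / 4 * (\<bar>jump f J * jump \<phi> J\<bar> * arc_length J)"
      using arc_length_pos[OF J] by (simp only: abs_mult)
  qed
  also have "\<dots> \<le> (\<Sum>J\<in>Sigma {..<N} (\<lambda>k. {..<2 ^ k}). 1 / 4 * (\<bar>jump f J * jump \<phi> J\<bar> * arc_length J))"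
    by (rule sum_mono2[OF _ AS]) (auto simp: arc_length_def)
  also have "\<dots> = 1 / 4 * (\<Sum>k<N. \<Sum>j<2 ^ k. \<bar>jump f (k, j) * jump \<phi> (k, j)\<bar> * arc_length (k, j))"
    by (subst sum.Sigma) (auto simp: sum_distrib_left intro!: sum.cong)
  also have "\<dots> \<le> 1 / 4 * (3 * B / 2 * t)"
    by (intro mult_left_mono order_trans[OF tree] sq) (use \<phi>B in auto)
  finally show ?thesis by simp
qed

section \<open>Haar functions\<close>

lemma integrable_times_haar:
  assumes "integrable circle f" "I \<in> dyadic_indices"
  shows "integrable circle (\<lambda>\<theta>. f \<theta> * haar I \<theta>)"
proof -
  have "integrable circle (\<lambda>\<theta>. (indicator (dyadic_arc (left_half I)) \<theta> *\<^sub>R f \<theta>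
      - indicator (dyadic_arc (right_half I)) \<theta> *\<^sub>R f \<theta>) / sqrt (arc_length I))"
    using assms arc_halves(1,2)[OF assms(2)]
    by (intro integrable_divide_zero Bochner_Integration.integrable_diff integrable_mult_indicator arc_sets) auto
  then show ?thesis by (simp add: haar_indicator[OF assms(2)] algebra_simps)
qed

lemma integrable_haar: "I \<in> dyadic_indices \<Longrightarrow> integrable circle (haar I)"
  using integrable_times_haar[of "\<lambda>_. 1" I] finite_measure.integrable_const[OF finite_measure_circle, of 1]
  by simp

lemma integral_haar:
  assumes "I \<in> dyadic_indices"
  shows "(LINT \<theta>|circle. haar I \<theta>) = 0"
proof -
  have "jump (\<lambda>_. 1) I = 0"
    using arc_halves(1,2)[OF assms] arc_length_pos arc_sets
    by (simp add: jump_def avg_def set_lebesgue_integral_def arc_length_def)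
       (metis (no_types, lifting) arc_length_def arc_length_pos arc_sets sets.sets_into_space Int_absorb2 less_irrefl)
  then show ?thesis
    using haar_coeff_jump[of "\<lambda>_. 1" I] assms finite_measure.integrable_const[OF finite_measure_circle, of 1]
    by (simp add: haar_coeff_def)
qed

lemma haar_eq_0: "I \<in> dyadic_indices \<Longrightarrow> \<theta> \<notin> dyadic_arc I \<Longrightarrow> haar I \<theta> = 0"
  using arc_halves(3)[of I] by (auto simp: haar_def)

text \<open>
  An arc of a later level lies inside a half of \<open>I\<close> or is disjoint from \<open>I\<close>, so the coarser Haar
  function is constant there; all points of the later arc have the same address up to its level.
\<close>

lemma haar_const_on_subarc:
  assumes I: "I \<in> dyadic_indices" and J: "J \<in> dyadic_indices" and less: "fst I < fst J"
  obtains c where "\<And>\<theta>. haar I \<theta> * haar J \<theta> = c * haar J \<theta>"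
proof -
  obtain \<theta>0 where \<theta>0: "\<theta>0 \<in> dyadic_arc J" using arc_nonempty[OF J] by auto
  obtain k i where Ik: "I = (k, i)" by (cases I)
  obtain k' j where Jk: "J = (k', j)" by (cases J)
  have pos: "norm \<theta> = 1 \<and> position (Suc k) \<theta> = j div 2 ^ (k' - Suc k)" if "\<theta> \<in> dyadic_arc J" for \<theta>
  proof -
    have n: "norm \<theta> = 1" using that arc_subset_circle[of J] by auto
    have "position k' \<theta> = j" using that arc_iff_position[OF n] J by (auto simp: Jk dyadic_indices_def)
    then show ?thesis
      using n position_div_power[of "Suc k" k' \<theta>] less by (simp add: Ik Jk del: position.simps(2))
  qed
  have "haar I \<theta> = haar I \<theta>0" if "\<theta> \<in> dyadic_arc J" for \<theta>
    using pos[OF that] pos[OF \<theta>0] arc_halves(1,2)[OF I]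
    by (simp add: haar_def Ik arc_iff_position dyadic_indices_def del: position.simps(2))
  then have "haar I \<theta> * haar J \<theta> = haar I \<theta>0 * haar J \<theta>" for \<theta>
    using haar_eq_0[OF J] by (cases "\<theta> \<in> dyadic_arc J") auto
  then show thesis by (rule that)
qed

lemma haar_orthonormal:
  assumes I: "I \<in> dyadic_indices" and J: "J \<in> dyadic_indices"
  shows "haar_coeff (haar J) I = (if I = J then 1 else 0)"
proof -
  consider "I = J" | "fst I < fst J" | "fst J < fst I" | "fst I = fst J" "snd I \<noteq> snd J"
    by (metis linorder_neqE_nat prod.expand)
  then show ?thesis
  proof cases
    case 1
    have "haar I \<theta> * haar I \<theta> = indicator (dyadic_arc I) \<theta> / arc_length I" for \<theta>
      using arc_halves(3,4)[OF I] arc_length_pos[OF I]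
      by (auto simp: haar_def indicator_def)
    then have "haar_coeff (haar I) I = measure circle (dyadic_arc I) / arc_length I"
      using arc_sets[OF I] sets.sets_into_space[OF arc_sets[OF I]]
      by (simp add: haar_coeff_def Int_absorb2)
    then show ?thesis using 1 arc_length_pos[OF I] by (simp add: arc_length_def)
  next
    case 2
    then obtain c where "\<And>\<theta>. haar I \<theta> * haar J \<theta> = c * haar J \<theta>"
      using haar_const_on_subarc[OF I J] by blast
    then have "haar_coeff (haar J) I = (LINT \<theta>|circle. c * haar J \<theta>)"
      by (simp only: haar_coeff_def mult.commute[of "haar J _"])
    then show ?thesis using 2 integral_haar[OF J] by auto
  next
    case 3
    then obtain c where "\<And>\<theta>. haar J \<theta> * haar I \<theta> = c * haar I \<theta>"
      using haar_const_on_subarc[OF J I] by blast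
    then have "haar_coeff (haar J) I = (LINT \<theta>|circle. c * haar I \<theta>)"
      by (simp only: haar_coeff_def)
    then show ?thesis using 3 integral_haar[OF I] by auto
  next
    case 4
    have "haar J \<theta> * haar I \<theta> = 0" for \<theta>
    proof (cases "\<theta> \<in> dyadic_arc I \<and> \<theta> \<in> dyadic_arc J")
      case True
      then have "norm \<theta> = 1" using arc_subset_circle[of I] by auto
      then show ?thesis
        using True 4 I J arc_iff_position by (cases I; cases J) (auto simp: dyadic_indices_def)
    qed (use haar_eq_0[OF I] haar_eq_0[OF J] in auto)
    then have "haar_coeff (haar J) I = (LINT \<theta>|circle. 0)"
      by (simp only: haar_coeff_def)
    then show ?thesis using 4 by auto
  qed
qed

lemma haar_coeff_add:
  "integrable circle f \<Longrightarrow> integrable circle g \<Longrightarrow> I \<in> dyadic_indices \<Longrightarrow>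
    haar_coeff (\<lambda>\<theta>. f \<theta> + g \<theta>) I = haar_coeff f I + haar_coeff g I"
  by (simp add: haar_coeff_def distrib_right integrable_times_haar)

lemma haar_coeff_cmult: "haar_coeff (\<lambda>\<theta>. c * f \<theta>) I = c * haar_coeff f I"
  by (simp add: haar_coeff_def mult.assoc)

definition haar_sum :: "(dyadic \<Rightarrow> real) \<Rightarrow> dyadic set \<Rightarrow> complex \<Rightarrow> real" where
  "haar_sum c A \<theta> = (\<Sum>J\<in>A. c J * haar J \<theta>)"

lemma integrable_haar_sum: "A \<subseteq> dyadic_indices \<Longrightarrow> integrable circle (haar_sum c A)"
  unfolding haar_sum_def by (intro Bochner_Integration.integrable_sum integrable_mult_right integrable_haar) auto

lemma haar_coeff_haar_sum:
  assumes "finite A" "A \<subseteq> dyadic_indices" "I \<in> dyadic_indices"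
  shows "haar_coeff (haar_sum c A) I = (if I \<in> A then c I else 0)"
proof -
  have "haar_coeff (haar_sum c A) I = (\<Sum>J\<in>A. c J * haar_coeff (haar J) I)"
    unfolding haar_coeff_def haar_sum_def sum_distrib_right mult.assoc
    using assms by (subst Bochner_Integration.integral_sum) 
      (auto intro!: integrable_mult_right integrable_times_haar integrable_haar)
  also have "\<dots> = (\<Sum>J\<in>A. if I = J then c J else 0)"
    using assms by (intro sum.cong) (auto simp: haar_orthonormal)
  finally show ?thesis using assms(1) by (simp add: sum.delta')
qed

lemma jump_haar_coeff:
  "integrable circle f \<Longrightarrow> I \<in> dyadic_indices \<Longrightarrow> jump f I = - (2 / sqrt (arc_length I)) * haar_coeff f I"
  using haar_coeff_jump[of f I] arc_length_pos[of I] by simp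

text \<open>
  The square function of the sum vanishes off \<open>J\<close>, so the constant of the mean inequality is paid
  only on \<open>J\<close>; the squares integrate to \<open>4 \<Sum> (c I)\<^sup>2\<close>. Optimizing over \<open>r\<close> would give
  \<open>2 sqrt (arc_length J * \<Sum> (c I)\<^sup>2)\<close>.
\<close>

lemma F_norm_haar_sum:
  assumes A: "finite A" "A \<subseteq> subarcs J" and J: "J \<in> dyadic_indices" and r: "0 < r"
  shows "F_norm (haar_sum c A) \<le> ennreal (r / 2 * arc_length J + 2 / r * (\<Sum>I\<in>A. (c I)\<^sup>2))"
proof -
  let ?g = "haar_sum c A" and ?h = "\<lambda>I. ennreal ((jump (haar_sum c A) I)\<^sup>2)"
  have AD: "A \<subseteq> dyadic_indices" using A(2) by (auto simp: subarcs_def)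
  have int: "integrable circle ?g" by (rule integrable_haar_sum[OF AD])
  have jump0: "jump ?g I = 0" if "I \<in> dyadic_indices" "I \<notin> A" for I
    using jump_haar_coeff[OF int that(1)] haar_coeff_haar_sum[OF A(1) AD that(1)] that by simp
  have sum_eq: "(\<Sum>k. ?h (k, position k \<theta>)) = (\<Sum>I\<in>A. ?h I * indicator (dyadic_arc I) \<theta>)"
    if "norm \<theta> = 1" for \<theta>
  proof -
    have "(\<Sum>k. ?h (k, position k \<theta>)) = (\<Sum>\<^sub>\<infinity>I\<in>{I \<in> dyadic_indices. \<theta> \<in> dyadic_arc I}. ?h I)"
      by (rule infsum_arcs_containing[OF that, symmetric])
    also have "\<dots> = (\<Sum>\<^sub>\<infinity>I\<in>A. ?h I * indicator (dyadic_arc I) \<theta>)"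
      using AD jump0 by (intro infsum_cong_neutral) (auto simp: indicator_def)
    finally show ?thesis using A(1) by simp
  qed
  have pt: "square_function (jump ?g) \<theta> \<le> ennreal (r / 2) * indicator (dyadic_arc J) \<theta>
      + ennreal (1 / (2 * r)) * (\<Sum>I\<in>A. ?h I * indicator (dyadic_arc I) \<theta>)"
    if "\<theta> \<in> space circle" for \<theta>
  proof -
    have n: "norm \<theta> = 1" using that by (simp add: space_circle)
    show ?thesis
    proof (cases "\<theta> \<in> dyadic_arc J")
      case True
      then show ?thesis unfolding square_function_def sum_eq[OF n] using esqrt_le_linear[OF r] by simp
    next
      case False
      then have "(\<Sum>I\<in>A. ?h I * indicator (dyadic_arc I) \<theta>) = 0"
        using A by (intro sum.neutral) (auto simp: subarcs_def indicator_def)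
      then show ?thesis unfolding square_function_def sum_eq[OF n] using esqrt_ennreal[of 0] by simp
    qed
  qed
  have m: "I \<in> A \<Longrightarrow> dyadic_arc I \<in> sets circle" for I using AD by (auto intro: arc_sets)
  have mJ: "dyadic_arc J \<in> sets circle" by (rule arc_sets[OF J])
  have "F_norm ?g \<le> (\<integral>\<^sup>+\<theta>. ennreal (r / 2) * indicator (dyadic_arc J) \<theta>
      + ennreal (1 / (2 * r)) * (\<Sum>I\<in>A. ?h I * indicator (dyadic_arc I) \<theta>) \<partial>circle)"
    unfolding F_norm_square_function by (intro nn_integral_mono pt)
  also have "\<dots> = ennreal (r / 2) * emeasure circle (dyadic_arc J)
      + ennreal (1 / (2 * r)) * (\<Sum>I\<in>A. ?h I * emeasure circle (dyadic_arc I))"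
    using m mJ by (subst nn_integral_add) (auto simp: nn_integral_cmult nn_integral_sum nn_integral_cmult_indicator)
  also have "(\<Sum>I\<in>A. ?h I * emeasure circle (dyadic_arc I)) = (\<Sum>I\<in>A. ennreal (4 * (c I)\<^sup>2))"
  proof (rule sum.cong[OF refl])
    fix I assume "I \<in> A"
    then have I: "I \<in> dyadic_indices" "I \<in> A" using AD by auto
    have "?h I * emeasure circle (dyadic_arc I) = ennreal ((jump ?g I)\<^sup>2 * arc_length I)"
      using I by (simp add: emeasure_arc arc_measurable_length(2) ennreal_mult[symmetric])
    then show "?h I * emeasure circle (dyadic_arc I) = ennreal (4 * (c I)\<^sup>2)"
      using jump_square[OF int I(1)] haar_coeff_haar_sum[OF A(1) AD I(1)] I by simp
  qed
  also have "\<dots> = ennreal (4 * (\<Sum>I\<in>A. (c I)\<^sup>2))"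
    by (simp add: sum_distrib_left)
  also have "ennreal (r / 2) * emeasure circle (dyadic_arc J)
      + ennreal (1 / (2 * r)) * ennreal (4 * (\<Sum>I\<in>A. (c I)\<^sup>2))
      = ennreal (r / 2 * arc_length J + 1 / (2 * r) * (4 * (\<Sum>I\<in>A. (c I)\<^sup>2)))"
    using r J arc_length_pos[OF J]
    by (simp only: emeasure_arc[OF J] arc_measurable_length(2)[OF J, symmetric])
       (simp add: ennreal_mult ennreal_plus sum_nonneg del: times_divide_eq_left times_divide_eq_right)
  also have "1 / (2 * r) * (4 * (\<Sum>I\<in>A. (c I)\<^sup>2)) = 2 / r * (\<Sum>I\<in>A. (c I)\<^sup>2)" by simp
  finally show ?thesis .
qed

section \<open>Square-summable Haar coefficients\<close>

lemma haar_bounded: "I \<in> dyadic_indices \<Longrightarrow> \<bar>haar I \<theta>\<bar> \<le> 1 / sqrt (arc_length I)"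
  using arc_length_pos[of I] by (auto simp: haar_def)

lemma integral_haar_sum_square:
  assumes A: "finite A" "A \<subseteq> dyadic_indices"
  shows "integrable circle (\<lambda>\<theta>. (haar_sum c A \<theta>)\<^sup>2)"
    and "(LINT \<theta>|circle. (haar_sum c A \<theta>)\<^sup>2) = (\<Sum>J\<in>A. (c J)\<^sup>2)"
proof -
  let ?g = "haar_sum c A"
  have sq: "(?g \<theta>)\<^sup>2 = (\<Sum>J\<in>A. c J * (?g \<theta> * haar J \<theta>))" for \<theta>
    by (simp add: power2_eq_square haar_sum_def sum_distrib_left mult.left_commute)
  have int: "J \<in> A \<Longrightarrow> integrable circle (\<lambda>\<theta>. c J * (?g \<theta> * haar J \<theta>))" for J
    using A by (intro integrable_mult_right integrable_times_haar integrable_haar_sum) auto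
  show "integrable circle (\<lambda>\<theta>. (?g \<theta>)\<^sup>2)"
    unfolding sq by (intro Bochner_Integration.integrable_sum int)
  have "(LINT \<theta>|circle. (?g \<theta>)\<^sup>2) = (\<Sum>J\<in>A. LINT \<theta>|circle. c J * (?g \<theta> * haar J \<theta>))"
    unfolding sq by (rule Bochner_Integration.integral_sum[OF int])
  also have "\<dots> = (\<Sum>J\<in>A. c J * haar_coeff ?g J)"
    by (simp add: haar_coeff_def)
  also have "\<dots> = (\<Sum>J\<in>A. (c J)\<^sup>2)"
    using A(1) by (intro sum.cong refl) (simp add: haar_coeff_haar_sum A subsetD[OF A(2)] power2_eq_square)
  finally show "(LINT \<theta>|circle. (?g \<theta>)\<^sup>2) = (\<Sum>J\<in>A. (c J)\<^sup>2)" .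
qed

lemma integral_abs_haar_sum:
  assumes A: "finite A" "A \<subseteq> dyadic_indices" and r: "0 < r" "(\<Sum>J\<in>A. (c J)\<^sup>2) \<le> r\<^sup>2"
  shows "(LINT \<theta>|circle. \<bar>haar_sum c A \<theta>\<bar>) \<le> r"
proof -
  let ?g = "haar_sum c A"
  note sq = integral_haar_sum_square[OF A, of c]
  have const: "integrable circle (\<lambda>_. r / 2)"
    by (rule finite_measure.integrable_const[OF finite_measure_circle])
  have "\<bar>?g \<theta>\<bar> \<le> r / 2 + 1 / (2 * r) * (?g \<theta>)\<^sup>2" for \<theta>
  proof -
    have "0 \<le> (\<bar>?g \<theta>\<bar> - r)\<^sup>2" by simp
    then have "2 * r * \<bar>?g \<theta>\<bar> \<le> r\<^sup>2 + (?g \<theta>)\<^sup>2" by (simp add: power2_diff algebra_simps)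
    then show ?thesis using r(1) by (simp add: field_simps power2_eq_square)
  qed
  then have "(LINT \<theta>|circle. \<bar>?g \<theta>\<bar>) \<le> (LINT \<theta>|circle. r / 2 + 1 / (2 * r) * (?g \<theta>)\<^sup>2)"
    using sq(1) const integrable_haar_sum[OF A(2)]
    by (intro integral_mono integrable_abs Bochner_Integration.integrable_add integrable_mult_right) auto
  also have "\<dots> = r / 2 + 1 / (2 * r) * (\<Sum>J\<in>A. (c J)\<^sup>2)"
    using sq const measure_circle by (subst Bochner_Integration.integral_add) auto
  also have "\<dots> \<le> r / 2 + 1 / (2 * r) * r\<^sup>2"
    using r by (intro add_left_mono mult_left_mono) auto
  also have "\<dots> = r" using r(1) by (simp add: field_simps power2_eq_square)
  finally show ?thesis .
qed

definition levels :: "nat \<Rightarrow> nat \<Rightarrow> dyadic set" where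
  "levels m n = {I \<in> dyadic_indices. m \<le> fst I \<and> fst I < n}"

lemma levels_Sigma: "levels m n = Sigma {m..<n} (\<lambda>k. {..<2 ^ k})"
  by (auto simp: levels_def dyadic_indices_def)

lemma finite_levels [simp]: "finite (levels m n)"
  by (simp add: levels_Sigma)

lemma levels_subset: "levels m n \<subseteq> dyadic_indices"
  by (auto simp: levels_def)

text \<open>
  The partial sums over levels are Cauchy in \<open>L\<^sup>2\<close>, hence in \<open>L\<^sup>1\<close>. The levels are grouped into blocks
  whose \<open>L\<^sup>1\<close> norms decay geometrically; then the series of blocks converges absolutely almost
  everywhere and in \<open>L\<^sup>1\<close>, and its Haar coefficients can be computed termwise because Haar functions
  are bounded.
\<close>

lemma riesz_fischer_haar:
  assumes bound: "\<And>A. finite A \<Longrightarrow> A \<subseteq> dyadic_indices \<Longrightarrow> (\<Sum>J\<in>A. (c J)\<^sup>2) \<le> K"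
  obtains \<phi> where "integrable circle \<phi>" "\<And>J. J \<in> dyadic_indices \<Longrightarrow> haar_coeff \<phi> J = c J"
proof -
  define s where "s k = (\<Sum>j<2 ^ k. (c (k, j))\<^sup>2)" for k
  have s_levels: "(\<Sum>k=m..<n. s k) = (\<Sum>J\<in>levels m n. (c J)\<^sup>2)" for m n
    unfolding s_def levels_Sigma by (subst sum.Sigma) (auto simp: case_prod_unfold)
  have "summable s"
  proof (rule bounded_imp_summable)
    show "0 \<le> s k" for k by (simp add: s_def sum_nonneg)
    show "(\<Sum>k\<le>n. s k) \<le> K" for n
    proof -
      have "(\<Sum>k\<le>n. s k) = (\<Sum>J\<in>levels 0 (Suc n). (c J)\<^sup>2)"
        by (simp only: s_levels[symmetric] atLeast0LessThan lessThan_Suc_atMost)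
      then show ?thesis using bound[OF finite_levels levels_subset] by simp
    qed
  qed
  then have "\<exists>N. \<forall>m\<ge>N. \<forall>n. norm (\<Sum>k=m..<n. s k) < ((1 / 2) ^ i)\<^sup>2" for i
    by (rule summable_Cauchy[THEN iffD1, rule_format]) simp
  then obtain M where M: "\<And>i m n. M i \<le> m \<Longrightarrow> norm (\<Sum>k=m..<n. s k) < ((1 / 2) ^ i)\<^sup>2"
    by metis
  \<comment> \<open>The summand \<open>1\<close> forces \<open>r\<close> to infinity, so that the blocks exhaust all levels.\<close>
  define r where "r i = (\<Sum>k<i. M k + 1)" for i
  have r0: "r 0 = 0" and r_Suc: "r (Suc i) = r i + M i + 1" for i by (simp_all add: r_def)
  have r_ge: "i \<le> r i" for i by (induction i) (auto simp: r_Suc)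
  define g where "g i = haar_sum c (levels (r i) (r (Suc i)))" for i
  have int: "integrable circle (g i)" for i
    unfolding g_def by (rule integrable_haar_sum[OF levels_subset])
  \<comment> \<open>The first block, starting at level \<open>0\<close>, is not controlled by \<open>M\<close>; hence the shifted index.\<close>
  have g_le: "(LINT \<theta>|circle. \<bar>g (Suc i) \<theta>\<bar>) \<le> (1 / 2) ^ i" for i
    unfolding g_def
  proof (rule integral_abs_haar_sum[OF finite_levels levels_subset])
    show "(\<Sum>J\<in>levels (r (Suc i)) (r (Suc (Suc i))). (c J)\<^sup>2) \<le> ((1 / 2) ^ i)\<^sup>2"
      unfolding s_levels[symmetric]
      by (rule order_trans[OF abs_ge_self less_imp_le[OF M[unfolded real_norm_def]]]) (simp add: r_Suc)
  qed simp
  have "summable (\<lambda>i. LINT \<theta>|circle. \<bar>g (Suc i) \<theta>\<bar>)"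
    by (rule summable_comparison_test'[OF summable_geometric[of "1 / 2 :: real"]])
       (use g_le in auto)
  then have sum_g: "summable (\<lambda>i. LINT \<theta>|circle. \<bar>g i \<theta>\<bar>)"
    by (subst (asm) summable_Suc_iff)
  have "(\<integral>\<^sup>+\<theta>. (\<Sum>i. ennreal \<bar>g i \<theta>\<bar>) \<partial>circle) = (\<Sum>i. \<integral>\<^sup>+\<theta>. ennreal \<bar>g i \<theta>\<bar> \<partial>circle)"
    using int by (intro nn_integral_suminf) auto
  also have "\<dots> = (\<Sum>i. ennreal (LINT \<theta>|circle. \<bar>g i \<theta>\<bar>))"
    using int by (intro suminf_cong nn_integral_eq_integral) auto
  also have "\<dots> \<noteq> \<infinity>"
    using sum_g by (simp add: ennreal_suminf_neq_top)
  finally have "AE \<theta> in circle. (\<Sum>i. ennreal \<bar>g i \<theta>\<bar>) \<noteq> \<infinity>"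
    using int by (intro nn_integral_PInf_AE) auto
  then have AE_g: "AE \<theta> in circle. summable (\<lambda>i. \<bar>g i \<theta>\<bar>)"
    by eventually_elim (auto intro: summable_suminf_not_top)
  define \<phi> where "\<phi> \<theta> = (\<Sum>i. g i \<theta>)" for \<theta>
  have "integrable circle \<phi>"
    unfolding \<phi>_def by (rule integrable_suminf) (use int AE_g sum_g in auto)
  moreover have "haar_coeff \<phi> J = c J" if J: "J \<in> dyadic_indices" for J
  proof -
    let ?b = "1 / sqrt (arc_length J)"
    have b: "norm (g i \<theta> * haar J \<theta>) \<le> \<bar>g i \<theta>\<bar> * ?b" for i \<theta>
      using haar_bounded[OF J, of \<theta>] by (simp add: abs_mult mult_left_mono del: times_divide_eq_right)
    have intJ: "integrable circle (\<lambda>\<theta>. g i \<theta> * haar J \<theta>)" for i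
      by (rule integrable_times_haar[OF int J])
    have AE_J: "AE \<theta> in circle. summable (\<lambda>i. norm (g i \<theta> * haar J \<theta>))"
      using AE_g
    proof eventually_elim
      case (elim \<theta>)
      show ?case
        by (rule summable_comparison_test'[OF summable_mult2[OF elim, of ?b]]) (use b in auto)
    qed
    have sum_J: "summable (\<lambda>i. LINT \<theta>|circle. norm (g i \<theta> * haar J \<theta>))"
    proof (rule summable_comparison_test'[OF summable_mult2[OF sum_g, of ?b]])
      fix i
      have "(LINT \<theta>|circle. norm (g i \<theta> * haar J \<theta>)) \<le> (LINT \<theta>|circle. \<bar>g i \<theta>\<bar> * ?b)"
        by (rule integral_mono) (use intJ int b in auto)
      then show "norm (LINT \<theta>|circle. norm (g i \<theta> * haar J \<theta>)) \<le> (LINT \<theta>|circle. \<bar>g i \<theta>\<bar>) * ?b"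
        by simp
    qed
    have "(\<lambda>i. haar_coeff (g i) J) sums (LINT \<theta>|circle. (\<Sum>i. g i \<theta> * haar J \<theta>))"
      unfolding haar_coeff_def by (rule sums_integral[OF intJ AE_J sum_J])
    also have "(LINT \<theta>|circle. (\<Sum>i. g i \<theta> * haar J \<theta>)) = haar_coeff \<phi> J"
      unfolding haar_coeff_def
    proof (rule integral_cong_AE)
      show "AE \<theta> in circle. (\<Sum>i. g i \<theta> * haar J \<theta>) = \<phi> \<theta> * haar J \<theta>"
        using AE_g
      proof eventually_elim
        case (elim \<theta>)
        then show ?case unfolding \<phi>_def by (intro suminf_mult2[symmetric]) (rule summable_rabs_cancel)
      qed
      show "(\<lambda>\<theta>. \<Sum>i. g i \<theta> * haar J \<theta>) \<in> borel_measurable circle"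
        using integrable_suminf[OF intJ AE_J sum_J] by auto
      show "(\<lambda>\<theta>. \<phi> \<theta> * haar J \<theta>) \<in> borel_measurable circle"
        using integrable_times_haar[OF \<open>integrable circle \<phi>\<close> J] by auto
    qed
    finally have "(\<lambda>n. \<Sum>i<n. haar_coeff (g i) J) \<longlonglongrightarrow> haar_coeff \<phi> J"
      by (simp add: sums_def)
    moreover have "haar_coeff (g i) J = (if r i \<le> fst J \<and> fst J < r (Suc i) then c J else 0)" for i
      unfolding g_def haar_coeff_haar_sum[OF finite_levels levels_subset J] using J by (simp add: levels_def)
    then have "(\<Sum>i<n. haar_coeff (g i) J) = (if fst J < r n then c J else 0)" for n
      by (induction n) (auto simp: r0 r_Suc)
    then have "eventually (\<lambda>n. (\<Sum>i<n. haar_coeff (g i) J) = c J) sequentially"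
      using r_ge by (intro eventually_sequentiallyI[of "Suc (fst J)"]) (auto simp: Suc_le_eq intro: less_le_trans)
    then have "(\<lambda>n. \<Sum>i<n. haar_coeff (g i) J) \<longlonglongrightarrow> c J"
      by (rule tendsto_eventually)
    ultimately show ?thesis by (rule LIMSEQ_unique)
  qed
  ultimately show thesis by (rule that)
qed

section \<open>Density of the finite Haar sums\<close>

lemma F_spaceD: "f \<in> F_space \<Longrightarrow> integrable circle f"
  by (simp add: F_space_def)

lemma haar_sum_in_F_space:
  assumes "finite A" "A \<subseteq> dyadic_indices"
  shows "haar_sum c A \<in> F_space"
proof -
  have "A \<subseteq> subarcs (0, 0)"
    using assms(2) arc_subset_circle arc_root by (auto simp: subarcs_def)
  then have "F_norm (haar_sum c A) < \<infinity>"
    using F_norm_haar_sum[OF assms(1), of "(0, 0)" 1 c]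
    by (auto simp: dyadic_indices_def intro: le_less_trans)
  then show ?thesis using integrable_haar_sum[OF assms(2)] by (simp add: F_space_def)
qed

lemma haar_in_F_space: "J \<in> dyadic_indices \<Longrightarrow> haar J \<in> F_space"
  using haar_sum_in_F_space[of "{J}" "\<lambda>_. 1"] by (simp add: haar_sum_def[abs_def])

lemma linear_on_F_haar_sum:
  assumes l: "linear_on_F l"
  shows "finite A \<Longrightarrow> A \<subseteq> dyadic_indices \<Longrightarrow> l (haar_sum c A) = (\<Sum>J\<in>A. c J * l (haar J))"
proof (induction A rule: finite_induct)
  case empty
  have "haar_sum c {} = (\<lambda>\<theta>. 0 * haar_sum c {} \<theta>)" by (simp add: haar_sum_def[abs_def])
  then have "l (haar_sum c {}) = 0 * l (haar_sum c {})"
    using l haar_sum_in_F_space[of "{}" c] unfolding linear_on_F_def by (metis empty_subsetI finite.emptyI)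
  then show ?case by simp
next
  case (insert J A)
  then have J: "J \<in> dyadic_indices" and A: "haar_sum c A \<in> F_space"
    using haar_sum_in_F_space by auto
  have cJ: "(\<lambda>\<theta>. c J * haar J \<theta>) \<in> F_space"
    using haar_sum_in_F_space[of "{J}" c] J by (simp add: haar_sum_def[abs_def])
  have "haar_sum c (insert J A) = (\<lambda>\<theta>. c J * haar J \<theta> + haar_sum c A \<theta>)"
    using insert.hyps by (simp add: haar_sum_def fun_eq_iff)
  then have "l (haar_sum c (insert J A)) = c J * l (haar J) + l (haar_sum c A)"
    using l cJ A haar_in_F_space[OF J] by (simp add: linear_on_F_def)
  then show ?case using insert by simp
qed

lemma tail_square_sum_tendsto:
  fixes a :: "nat \<Rightarrow> real"
  assumes "(\<Sum>k. ennreal ((a k)\<^sup>2)) \<noteq> \<infinity>"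
  shows "(\<lambda>n. esqrt (\<Sum>k. if k < n then 0 else ennreal ((a k)\<^sup>2))) \<longlonglongrightarrow> 0"
proof -
  have s: "summable (\<lambda>k. (a k)\<^sup>2)" using assms by (intro summable_suminf_not_top) auto
  have s': "summable (\<lambda>k. (a (k + n))\<^sup>2)" for n
    by (rule summable_ignore_initial_segment[OF s])
  have tail: "esqrt (\<Sum>k. if k < n then 0 else ennreal ((a k)\<^sup>2)) = ennreal (sqrt (\<Sum>k. (a (k + n))\<^sup>2))" for n
  proof -
    have "(\<Sum>k. if k < n then 0 else ennreal ((a k)\<^sup>2)) = (\<Sum>k. ennreal ((a (k + n))\<^sup>2))"
      by (subst suminf_offset[of _ n]) auto
    also have "\<dots> = ennreal (\<Sum>k. (a (k + n))\<^sup>2)"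
      by (intro suminf_ennreal2 s') auto
    finally show ?thesis by (simp add: esqrt_ennreal suminf_nonneg[OF s'])
  qed
  have "(\<lambda>n. \<Sum>k. (a (k + n))\<^sup>2) \<longlonglongrightarrow> 0"
  proof (rule LIMSEQ_I)
    fix e :: real assume "0 < e"
    then show "\<exists>N. \<forall>n\<ge>N. norm ((\<Sum>k. (a (k + n))\<^sup>2) - 0) < e"
      using suminf_exist_split[OF _ s] by simp
  qed
  then have "(\<lambda>n. ennreal (sqrt (\<Sum>k. (a (k + n))\<^sup>2))) \<longlonglongrightarrow> ennreal (sqrt 0)"
    by (intro tendsto_ennrealI tendsto_real_sqrt)
  then show ?thesis by (simp add: tail)
qed

text \<open>
  Subtracting the Haar sum over the first \<open>n\<close> levels removes exactly the jumps of these levels, so the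
  square function of the difference is the tail of that of \<open>f\<close>. The tail tends to \<open>0\<close> wherever
  the square function of \<open>f\<close> is finite, and that function dominates. The mean of \<open>f\<close> is lost in the
  approximation, but constants have norm \<open>0\<close>.
\<close>

lemma haar_sums_dense:
  assumes f: "f \<in> F_space"
  shows "(\<lambda>n. F_norm (\<lambda>\<theta>. haar_sum (haar_coeff f) (levels 0 n) \<theta> - f \<theta>)) \<longlonglongrightarrow> 0"
proof -
  let ?T = "\<lambda>n. haar_sum (haar_coeff f) (levels 0 n)"
  let ?u = "\<lambda>n \<theta>. square_function (jump (\<lambda>\<theta>. ?T n \<theta> - f \<theta>)) \<theta>"
  let ?a = "\<lambda>\<theta> k. jump f (k, position k \<theta>)"
  have int: "integrable circle f" by (rule F_spaceD[OF f])
  have jump_T: "jump (?T n) I = (if fst I < n then jump f I else 0)" if I: "I \<in> dyadic_indices" for n I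
    using jump_haar_coeff[OF integrable_haar_sum[OF levels_subset, of "haar_coeff f" 0 n] I]
      jump_haar_coeff[OF int I] haar_coeff_haar_sum[OF finite_levels levels_subset I, of "haar_coeff f" 0 n] I
    by (simp add: levels_def)
  have u: "?u n \<theta> = esqrt (\<Sum>k. if k < n then 0 else ennreal ((?a \<theta> k)\<^sup>2))" for n \<theta>
    unfolding square_function_def
    by (intro arg_cong[where f = esqrt] suminf_cong)
       (simp add: jump_diff[OF integrable_haar_sum[OF levels_subset] int] jump_T)
  have "(\<lambda>n. \<integral>\<^sup>+\<theta>. ?u n \<theta> \<partial>circle) \<longlonglongrightarrow> (\<integral>\<^sup>+\<theta>. 0 \<partial>circle)"
  proof (rule nn_integral_dominated_convergence[where w = "square_function (jump f)"])
    show "AE \<theta> in circle. ?u n \<theta> \<le> square_function (jump f) \<theta>" for n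
      unfolding u unfolding square_function_def by (intro AE_I2 esqrt_mono suminf_le) auto
    show finite: "(\<integral>\<^sup>+\<theta>. square_function (jump f) \<theta> \<partial>circle) < \<infinity>"
      using f by (simp add: F_space_def F_norm_square_function)
    have "AE \<theta> in circle. square_function (jump f) \<theta> \<noteq> \<infinity>"
      using finite by (intro nn_integral_PInf_AE) auto
    then show "AE \<theta> in circle. (\<lambda>n. ?u n \<theta>) \<longlonglongrightarrow> 0"
    proof eventually_elim
      case (elim \<theta>)
      then have "(\<Sum>k. ennreal ((?a \<theta> k)\<^sup>2)) \<noteq> \<infinity>"
        by (auto simp: square_function_def esqrt_def)
      then show ?case unfolding u by (rule tail_square_sum_tendsto)
    qed
  qed auto
  then show ?thesis by (simp add: F_norm_square_function)
qed

lemma F_dual_eqI: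
  assumes l: "l \<in> F_dual" and l': "l' \<in> F_dual"
    and eq: "\<And>J. J \<in> dyadic_indices \<Longrightarrow> l (haar J) = l' (haar J)" and f: "f \<in> F_space"
  shows "l f = l' f"
proof -
  let ?T = "\<lambda>n. haar_sum (haar_coeff f) (levels 0 n)"
  have T: "?T n \<in> F_space" for n by (intro haar_sum_in_F_space finite_levels levels_subset)
  have lim: "(\<lambda>n. m (?T n)) \<longlonglongrightarrow> m f" if m: "m \<in> F_dual" for m
  proof (rule LIMSEQ_I)
    fix e :: real assume "0 < e"
    then obtain \<delta> where \<delta>: "0 < \<delta>"
      "\<And>g. g \<in> F_space \<Longrightarrow> F_norm (\<lambda>\<theta>. g \<theta> - f \<theta>) < ennreal \<delta> \<Longrightarrow> \<bar>m g - m f\<bar> < e"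
      using m f unfolding F_dual_def continuous_on_F_def by blast
    have "eventually (\<lambda>n. F_norm (\<lambda>\<theta>. ?T n \<theta> - f \<theta>) < ennreal \<delta>) sequentially"
      using \<delta>(1) by (intro order_tendstoD(2)[OF haar_sums_dense[OF f]]) simp
    then show "\<exists>N. \<forall>n\<ge>N. norm (m (?T n) - m f) < e"
      using \<delta>(2)[OF T] unfolding eventually_sequentially by fastforce
  qed
  have "l (?T n) = (\<Sum>J\<in>levels 0 n. haar_coeff f J * l (haar J))" for n
    using l by (intro linear_on_F_haar_sum finite_levels levels_subset) (simp add: F_dual_def)
  also have "(\<Sum>J\<in>levels 0 n. haar_coeff f J * l (haar J))
      = (\<Sum>J\<in>levels 0 n. haar_coeff f J * l' (haar J))" for n
    using eq subsetD[OF levels_subset[of 0 n]] by (intro sum.cong refl) simp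
  also have "(\<Sum>J\<in>levels 0 n. haar_coeff f J * l' (haar J)) = l' (?T n)" for n
    using l' by (intro linear_on_F_haar_sum[symmetric] finite_levels levels_subset) (simp add: F_dual_def)
  finally have "l (?T n) = l' (?T n)" for n .
  then show ?thesis using lim[OF l] lim[OF l'] LIMSEQ_unique by simp
qed

section \<open>BMO functions act continuously\<close>

text \<open>
  The bound is stated with arbitrary majorants \<open>t\<close> and \<open>B\<close> of the two norms, because the norms
  themselves are extended-valued and \<open>B\<close> has to be positive.
\<close>

lemma haar_functional_bound:
  assumes f: "integrable circle f" and \<phi>: "integrable circle \<phi>"
    and ft: "F_norm f \<le> ennreal t" "0 \<le> t" and \<phi>B: "BMO_norm \<phi> \<le> ennreal B" "0 < B"
  shows "(\<lambda>J. \<bar>haar_coeff f J * haar_coeff \<phi> J\<bar>) summable_on dyadic_indices"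
    and "\<bar>haar_functional \<phi> f\<bar> \<le> 3 * B * t / 8"
proof -
  let ?p = "\<lambda>J. haar_coeff f J * haar_coeff \<phi> J"
  note fin = fefferman_inequality[OF f \<phi> ft \<phi>B]
  show s: "(\<lambda>J. \<bar>?p J\<bar>) summable_on dyadic_indices"
    using fin by (intro nonneg_bdd_above_summable_on bdd_aboveI2[where M = "3 * B * t / 8"]) auto
  have "\<bar>haar_functional \<phi> f\<bar> \<le> (\<Sum>\<^sub>\<infinity>J\<in>dyadic_indices. \<bar>?p J\<bar>)"
    unfolding haar_functional_def using norm_infsum_bound[of ?p dyadic_indices] s by simp
  also have "\<dots> \<le> 3 * B * t / 8"
    by (intro infsum_le_finite_sums[OF s] fin)
  finally show "\<bar>haar_functional \<phi> f\<bar> \<le> 3 * B * t / 8" .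
qed

lemma haar_functional_in_F_dual:
  assumes \<phi>: "\<phi> \<in> BMO_space"
  shows "f \<in> F_space \<Longrightarrow> (\<lambda>J. \<bar>haar_coeff f J * haar_coeff \<phi> J\<bar>) summable_on dyadic_indices"
    and "haar_functional \<phi> \<in> F_dual"
proof -
  have int\<phi>: "integrable circle \<phi>" using \<phi> by (simp add: BMO_space_def)
  define B where "B = enn2real (BMO_norm \<phi>) + 1"
  have B: "0 < B" unfolding B_def by (simp add: add_nonneg_pos)
  have "BMO_norm \<phi> = ennreal (enn2real (BMO_norm \<phi>))"
    using \<phi> by (simp add: BMO_space_def)
  also have "\<dots> \<le> ennreal B" unfolding B_def by (intro ennreal_leI) simp
  finally have BMO: "BMO_norm \<phi> \<le> ennreal B" .
  have F: "F_norm f \<le> ennreal (enn2real (F_norm f))" if "f \<in> F_space" for f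
    using that by (simp add: F_space_def)
  show abs: "(\<lambda>J. \<bar>haar_coeff f J * haar_coeff \<phi> J\<bar>) summable_on dyadic_indices" if "f \<in> F_space" for f
    by (rule haar_functional_bound(1)[OF F_spaceD[OF that] int\<phi> F[OF that] _ BMO B]) simp
  have sum: "(\<lambda>J. haar_coeff f J * haar_coeff \<phi> J) summable_on dyadic_indices" if "f \<in> F_space" for f
    using abs[OF that] by (rule abs_summable_summable[where 'b = real, unfolded real_norm_def])
  have add: "haar_functional \<phi> (\<lambda>\<theta>. f \<theta> + g \<theta>) = haar_functional \<phi> f + haar_functional \<phi> g"
    if "f \<in> F_space" "g \<in> F_space" for f g
  proof -
    have "haar_functional \<phi> (\<lambda>\<theta>. f \<theta> + g \<theta>)
        = (\<Sum>\<^sub>\<infinity>J\<in>dyadic_indices. haar_coeff f J * haar_coeff \<phi> J + haar_coeff g J * haar_coeff \<phi> J)"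
      unfolding haar_functional_def using that
      by (intro infsum_cong) (simp add: haar_coeff_add F_spaceD distrib_right)
    then show ?thesis using that by (simp add: haar_functional_def infsum_add sum)
  qed
  have cmult: "haar_functional \<phi> (\<lambda>\<theta>. c * f \<theta>) = c * haar_functional \<phi> f" for c f
    unfolding haar_functional_def by (simp add: haar_coeff_cmult mult.assoc infsum_cmult_right')
  have "continuous_on_F (haar_functional \<phi>)"
    unfolding continuous_on_F_def
  proof (intro ballI allI impI)
    fix f and e :: real assume f: "f \<in> F_space" and e: "0 < e"
    \<comment> \<open>The functional has norm at most \<open>3 * B / 8 < B\<close>.\<close>
    define \<delta> where "\<delta> = e / B"
    have \<delta>: "0 < \<delta>" using e B by (simp add: \<delta>_def)
    have "\<bar>haar_functional \<phi> g - haar_functional \<phi> f\<bar> < e"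
      if g: "g \<in> F_space" and d: "F_norm (\<lambda>\<theta>. g \<theta> - f \<theta>) < ennreal \<delta>" for g
    proof -
      let ?h = "\<lambda>\<theta>. g \<theta> - f \<theta>"
      have int: "integrable circle ?h" using f g F_spaceD by auto
      then have h: "?h \<in> F_space" using d by (auto simp: F_space_def intro: less_trans)
      have "haar_functional \<phi> (\<lambda>\<theta>. ?h \<theta> + f \<theta>) = haar_functional \<phi> ?h + haar_functional \<phi> f"
        by (rule add[OF h f])
      then have "\<bar>haar_functional \<phi> g - haar_functional \<phi> f\<bar> = \<bar>haar_functional \<phi> ?h\<bar>" by simp
      also have "\<dots> \<le> 3 * B * \<delta> / 8"
        using d \<delta> by (intro haar_functional_bound(2)[OF int int\<phi> _ _ BMO B]) auto
      also have "\<dots> < e" using e B by (simp add: \<delta>_def)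
      finally show ?thesis .
    qed
    then show "\<exists>\<delta>>0. \<forall>g\<in>F_space. F_norm (\<lambda>\<theta>. g \<theta> - f \<theta>) < ennreal \<delta> \<longrightarrow>
        \<bar>haar_functional \<phi> g - haar_functional \<phi> f\<bar> < e"
      using \<delta> by blast
  qed
  then show "haar_functional \<phi> \<in> F_dual"
    by (simp add: F_dual_def linear_on_F_def add cmult)
qed

lemma haar_functional_haar:
  assumes "J \<in> dyadic_indices"
  shows "haar_functional \<phi> (haar J) = haar_coeff \<phi> J"
proof -
  have "haar_functional \<phi> (haar J) = (\<Sum>\<^sub>\<infinity>I\<in>{J}. haar_coeff (haar J) I * haar_coeff \<phi> I)"
    unfolding haar_functional_def
    using assms by (intro infsum_cong_neutral) (auto simp: haar_orthonormal)
  then show ?thesis using assms by (simp add: haar_orthonormal)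
qed

section \<open>Every functional comes from a BMO function\<close>

text \<open>
  Majorants \<open>t > 0\<close> of the norm cover functions of norm \<open>0\<close>, which cannot be normalized.
\<close>

lemma F_dual_bounded:
  assumes l: "l \<in> F_dual"
  obtains C where "0 < C" "\<And>f t. f \<in> F_space \<Longrightarrow> 0 < t \<Longrightarrow> F_norm f \<le> ennreal t \<Longrightarrow> \<bar>l f\<bar> \<le> C * t"
proof -
  have lin: "\<And>c f. f \<in> F_space \<Longrightarrow> l (\<lambda>\<theta>. c * f \<theta>) = c * l f"
    using l by (simp add: F_dual_def linear_on_F_def)
  have zero: "(\<lambda>_. 0) \<in> F_space"
    using haar_sum_in_F_space[of "{}"] by (simp add: haar_sum_def[abs_def])
  have l0: "l (\<lambda>_. 0) = 0" using lin[OF zero, of 0] by simp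
  have "continuous_on_F l" using l by (simp add: F_dual_def)
  note this[unfolded continuous_on_F_def, rule_format, OF zero zero_less_one]
  then obtain \<delta> where \<delta>: "0 < \<delta>" "\<And>g. g \<in> F_space \<Longrightarrow> F_norm g < ennreal \<delta> \<Longrightarrow> \<bar>l g\<bar> < 1"
    using l0 by auto
  show thesis
  proof (rule that)
    show "0 < 2 / \<delta>" using \<delta> by simp
    fix f and t :: real assume f: "f \<in> F_space" and t: "0 < t" and ft: "F_norm f \<le> ennreal t"
    define c where "c = \<delta> / (2 * t)"
    have c: "0 < c" using \<delta> t by (simp add: c_def)
    have "F_norm (\<lambda>\<theta>. c * f \<theta>) \<le> ennreal \<bar>c\<bar> * F_norm f" by (rule F_norm_cmult)
    also have "\<dots> \<le> ennreal c * ennreal t" using ft c by (intro mult_mono) auto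
    also have "\<dots> = ennreal (\<delta> / 2)" using c t by (simp add: ennreal_mult[symmetric] c_def)
    also have "\<dots> < ennreal \<delta>" using \<delta> by (simp add: ennreal_lessI)
    finally have cf: "F_norm (\<lambda>\<theta>. c * f \<theta>) < ennreal \<delta>" .
    then have "(\<lambda>\<theta>. c * f \<theta>) \<in> F_space"
      using F_spaceD[OF f] by (auto simp: F_space_def intro: less_trans)
    then have "\<bar>c * l f\<bar> < 1" using \<delta>(2)[OF _ cf] lin[OF f] by simp
    then show "\<bar>l f\<bar> \<le> 2 / \<delta> * t"
      using c t \<delta> by (simp add: c_def abs_mult field_simps)
  qed
qed

lemma F_dual_representation:
  assumes l: "l \<in> F_dual"
  obtains \<phi> where "\<phi> \<in> BMO_space" "\<And>f. f \<in> F_space \<Longrightarrow> l f = haar_functional \<phi> f"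
proof -
  obtain C where C: "0 < C"
    "\<And>f t. f \<in> F_space \<Longrightarrow> 0 < t \<Longrightarrow> F_norm f \<le> ennreal t \<Longrightarrow> \<bar>l f\<bar> \<le> C * t"
    using F_dual_bounded[OF l] by blast
  define b where "b J = l (haar J)" for J
  have b_bound: "(\<Sum>I\<in>A. (b I)\<^sup>2) \<le> 4 * C\<^sup>2 * arc_length J"
    if A: "finite A" "A \<subseteq> subarcs J" and J: "J \<in> dyadic_indices" for A J
  proof -
    let ?X = "\<Sum>I\<in>A. (b I)\<^sup>2"
    \<comment> \<open>The parameter \<open>4 * C\<close> turns the second summand of \<open>C * ?t\<close> into \<open>?X / 2\<close>, which is absorbed.\<close>
    let ?t = "4 * C / 2 * arc_length J + 2 / (4 * C) * ?X"
    have AD: "A \<subseteq> dyadic_indices" using A(2) by (auto simp: subarcs_def)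
    have X: "0 \<le> ?X" by (simp add: sum_nonneg)
    have "l (haar_sum b A) = ?X"
      using linear_on_F_haar_sum[of l A b] l A(1) AD by (simp add: F_dual_def b_def power2_eq_square)
    moreover have "\<bar>l (haar_sum b A)\<bar> \<le> C * ?t"
    proof (rule C(2)[OF haar_sum_in_F_space[OF A(1) AD]])
      show "0 < ?t" using C(1) X arc_length_pos[OF J] by (intro add_pos_nonneg) auto
      show "F_norm (haar_sum b A) \<le> ennreal ?t"
        using C(1) by (intro F_norm_haar_sum A J) simp
    qed
    moreover have "C * ?t = 2 * C\<^sup>2 * arc_length J + ?X / 2"
      using C(1) by (simp add: field_simps power2_eq_square)
    ultimately show ?thesis by simp
  qed
  have root: "(0, 0) \<in> dyadic_indices" by (simp add: dyadic_indices_def)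
  have sub: "A \<subseteq> subarcs (0, 0)" if "A \<subseteq> dyadic_indices" for A
    using that arc_subset_circle arc_root by (auto simp: subarcs_def)
  obtain \<phi> where \<phi>: "integrable circle \<phi>" "\<And>J. J \<in> dyadic_indices \<Longrightarrow> haar_coeff \<phi> J = b J"
    using riesz_fischer_haar[of b, OF b_bound[OF _ sub root]] by blast
  have "BMO_norm \<phi> \<le> ennreal (4 * C)"
    unfolding BMO_norm_carleson_mass
  proof (rule SUP_least)
    fix J assume J: "J \<in> dyadic_indices"
    have l: "0 < arc_length J" by (rule arc_length_pos[OF J])
    have "carleson_mass \<phi> J \<le> ennreal (16 * C\<^sup>2 * arc_length J)"
      unfolding carleson_mass_def
    proof (rule infsum_le_finite_sums[OF nonneg_summable_on_complete])
      fix A assume A: "finite A" "A \<subseteq> subarcs J"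
      have "(\<Sum>I\<in>A. ennreal ((jump \<phi> I)\<^sup>2 * arc_length I)) = (\<Sum>I\<in>A. ennreal (4 * (b I)\<^sup>2))"
        using A(2) by (intro sum.cong) (auto simp: subarcs_def jump_square \<phi>)
      also have "\<dots> = ennreal (4 * (\<Sum>I\<in>A. (b I)\<^sup>2))" by (simp add: sum_distrib_left)
      also have "\<dots> \<le> ennreal (16 * C\<^sup>2 * arc_length J)"
        using b_bound[OF A J] by (intro ennreal_leI) linarith
      finally show "(\<Sum>I\<in>A. ennreal ((jump \<phi> I)\<^sup>2 * arc_length I)) \<le> ennreal (16 * C\<^sup>2 * arc_length J)" .
    qed simp
    then have "ennreal (1 / arc_length J) * carleson_mass \<phi> J
        \<le> ennreal (1 / arc_length J) * ennreal (16 * C\<^sup>2 * arc_length J)"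
      by (rule mult_left_mono) simp
    also have "\<dots> = ennreal ((4 * C)\<^sup>2)"
      using l by (simp add: ennreal_mult[symmetric] power_mult_distrib)
    finally have "esqrt (ennreal (1 / arc_length J) * carleson_mass \<phi> J) \<le> esqrt (ennreal ((4 * C)\<^sup>2))"
      by (rule esqrt_mono)
    moreover have "sqrt ((4 * C)\<^sup>2) = 4 * C"
      using C(1) by (intro real_sqrt_unique refl) simp
    ultimately show "esqrt (ennreal (1 / arc_length J) * carleson_mass \<phi> J) \<le> ennreal (4 * C)"
      by (metis esqrt_ennreal zero_le_power2)
  qed
  then have BMO: "\<phi> \<in> BMO_space"
    using \<phi>(1) by (auto simp: BMO_space_def intro: le_less_trans)
  show thesis
  proof (rule that[OF BMO])
    show "l f = haar_functional \<phi> f" if "f \<in> F_space" for f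
      by (rule F_dual_eqI[OF l haar_functional_in_F_dual(2)[OF BMO] _ that])
         (simp add: haar_functional_haar \<phi>(2) b_def)
  qed
qed

theorem theorem2p1:
  "(\<forall>\<phi>\<in>BMO_space.
      (\<forall>f\<in>F_space. (\<lambda>J. \<bar>haar_coeff f J * haar_coeff \<phi> J\<bar>) summable_on dyadic_indices) \<and>
      haar_functional \<phi> \<in> F_dual) \<and>
   (\<forall>l\<in>F_dual. \<exists>\<phi>\<in>BMO_space. \<forall>f\<in>F_space. l f = haar_functional \<phi> f)"
  using haar_functional_in_F_dual F_dual_representation by metis

end
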